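(* Let $\mathbb F$ be a field and $f$ an $\mathbb F$-valued graph parameter with $f(K_0)=1$ such that there exists an integer $q\ge 0$ with $\operatorname{rk_\mathsf S} T(f,k,n)\le q^k$ for all integers $k,n\ge 0$. Then there exists an $\mathbb F$-weighted graph $H$ with $|V(H)|\le q$ such that $f(G)=\hom(G,H)$ for every graph $G$.
   Context: Graphs $G$ are finite, may have multiple edges but no loops; $K_0$ is the empty graph. An $\mathbb F$-valued graph parameter is an isomorphism-invariant function from graphs to $\mathbb F$. An $\mathbb F$-weighted graph $H$ is given by $q'=|V(H)|\ge0$, vertex weights $\alpha_1,\dots,\alpha_{q'}\in\mathbb F\setminus\{0\}$ and a symmetric matrix $B=(\beta_{ij})\in\mathbb F^{q'\times q'}$; $\hom(G,H)=\sum_{\phi:V(G)\to[q']}\prod_{u\in V(G)}\alpha_{\phi(u)}\prod_{uv\in E(G)}\beta_{\phi(u)\phi(v)}$ (edges with multiplicity; empty products equal $1$). For $k\ge 0$, a $k$-labeled graph is a graph in which $k$ distinct nodes carry labels $1,\dots,k$, identified up to label-preserving isomorphism; graph parameters ignore labels. The product of $k$-labeled graphs is the disjoint union with equally-labeled nodes identified. $\mathcal{PLG}[k]$ is the set of $k$-labeled graphs and $U_k$ the edgeless $k$-labeled graph on $k$ nodes. The connection tensor $T(f,k,n)$ is the function $(G_1,\dots,G_n)\mapsto f(G_1\cdots G_n)$ on $\mathcal{PLG}[k]^n$ (for $n=0$ the scalar $f(U_k)$). For $\mathbf x\in\mathbb F^{\mathcal{PLG}[k]}$, $\mathbf x^{\otimes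 n}(G_1,\dots,G_n)=\prod_i\mathbf x(G_i)$, $\mathbf x^{\otimes0}=1$. $\operatorname{rk_\mathsf S}T$ is the least $r\ge0$ with $T=\sum_{i=1}^r\lambda_i\mathbf x_i^{\otimes n}$, $\lambda_i\in\mathbb F$, $\mathbf x_i\in\mathbb F^{\mathcal{PLG}[k]}$ ($\infty$ if none). *)

theory Defs
  imports Main "HOL-Library.Multiset" "HOL-Library.FuncSet" "HOL-Library.Extended_Nat"
begin

text \<open>Vertices are natural numbers; every finite graph is isomorphic to one of these. An edge is a
  two-element set of vertices (so there are no loops), and parallel edges are repeated members of
  the multiset.\<close>

record mgraph =
  verts :: "nat set"
  edges :: "nat set multiset"

definition is_graph :: "'b mgraph_scheme \<Rightarrow> bool" where
  "is_graph G \<longleftrightarrow> finite (verts G) \<and> (\<forall>e\<in>#edges G. e \<subseteq> verts G \<and> card e = 2)"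

definition graph_iso :: "(nat \<Rightarrow> nat) \<Rightarrow> 'b mgraph_scheme \<Rightarrow> 'c mgraph_scheme \<Rightarrow> bool" where
  "graph_iso \<pi> G H \<longleftrightarrow>
     bij_betw \<pi> (verts G) (verts H) \<and> edges H = image_mset (\<lambda>e. \<pi> ` e) (edges G)"

definition K0 :: mgraph where
  "K0 = \<lparr>verts = {}, edges = {#}\<rparr>"

definition graph_parameter :: "(mgraph \<Rightarrow> 'a) \<Rightarrow> bool" where
  "graph_parameter f \<longleftrightarrow>
     (\<forall>G H. is_graph G \<longrightarrow> is_graph H \<longrightarrow> (\<exists>\<pi>. graph_iso \<pi> G H) \<longrightarrow> f G = f H)"

text \<open>The vertex set of a weighted graph of order \<open>q\<close> is \<open>{..<q}\<close>. The weights are meaningful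
  only on these indices.\<close>

record 'a wgraph =
  worder :: nat
  vweight :: "nat \<Rightarrow> 'a"
  eweight :: "nat \<Rightarrow> nat \<Rightarrow> 'a"

definition weighted_graph :: "'a::field wgraph \<Rightarrow> bool" where
  "weighted_graph H \<longleftrightarrow>
     (\<forall>i<worder H. vweight H i \<noteq> 0) \<and>
     (\<forall>i<worder H. \<forall>j<worder H. eweight H i j = eweight H j i)"

text \<open>An edge \<open>uv\<close> is the set \<open>{u, v}\<close>, so its endpoints are its minimum and maximum; by symmetry
  of the edge weights the order of the two endpoints is irrelevant.\<close>

definition hom :: "mgraph \<Rightarrow> 'a::field wgraph \<Rightarrow> 'a" where
  "hom G H = (\<Sum>\<phi> \<in> verts G \<rightarrow>\<^sub>E {..<worder H}.
     (\<Prod>u\<in>verts G. vweight H (\<phi> u)) *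
     (\<Prod>e\<in>#edges G. eweight H (\<phi> (Min e)) (\<phi> (Max e))))"

text \<open>The node with label \<open>i\<close> (for \<open>1 \<le> i \<le> k\<close>) is \<open>labels G ! (i - 1)\<close>. The underlying unlabeled
  graph is \<open>mgraph.truncate G\<close>.\<close>

record lgraph = mgraph +
  labels :: "nat list"

definition PLG :: "nat \<Rightarrow> lgraph set" where
  "PLG k = {G. is_graph G \<and> length (labels G) = k \<and> distinct (labels G) \<and> set (labels G) \<subseteq> verts G}"

definition labeled_iso :: "lgraph \<Rightarrow> lgraph \<Rightarrow> bool" where
  "labeled_iso G H \<longleftrightarrow> (\<exists>\<pi>. graph_iso \<pi> G H \<and> map \<pi> (labels G) = labels H)"

text \<open>Since \<open>k\<close>-labeled graphs are identified up to label-preserving isomorphism, functions on them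
  are the isomorphism-invariant functions on the concrete representatives.\<close>

definition PLG_functions :: "nat \<Rightarrow> (lgraph \<Rightarrow> 'a) set" where
  "PLG_functions k = {x. \<forall>G\<in>PLG k. \<forall>H\<in>PLG k. labeled_iso G H \<longrightarrow> x G = x H}"

definition U_graph :: "nat \<Rightarrow> lgraph" where
  "U_graph k = \<lparr>verts = {..<k}, edges = {#}, labels = [0..<k]\<rparr>"

text \<open>To form the product, the labeled nodes are renamed to their positions in the label list, and
  the unlabeled nodes of the first (\<open>c = 0\<close>) and second (\<open>c = 1\<close>) factor to disjoint sets of larger
  numbers.\<close>

definition glue_name :: "nat list \<Rightarrow> nat \<Rightarrow> nat \<Rightarrow> nat" where
  "glue_name ls c v =
     (if v \<in> set ls then length (takeWhile (\<lambda>w. w \<noteq> v) ls) else length ls + 2 * v + c)"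

definition lprod :: "lgraph \<Rightarrow> lgraph \<Rightarrow> lgraph" where
  "lprod G H =
     (let \<pi> = glue_name (labels G) 0; \<rho> = glue_name (labels H) 1 in
      \<lparr>verts = \<pi> ` verts G \<union> \<rho> ` verts H,
       edges = image_mset (\<lambda>e. \<pi> ` e) (edges G) + image_mset (\<lambda>e. \<rho> ` e) (edges H),
       labels = [0..<length (labels G)]\<rparr>)"

text \<open>\<open>U_graph k\<close> is the unit of the product, so up to isomorphism the fold below is the product of the
  list, and it is \<open>U_graph k\<close> for the empty list. The order of the tensor is the length of the list.\<close>

definition conn_tensor :: "(mgraph \<Rightarrow> 'a) \<Rightarrow> nat \<Rightarrow> lgraph list \<Rightarrow> 'a" where
  "conn_tensor f k Gs = f (mgraph.truncate (foldr lprod Gs (U_graph k)))"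

definition tensor_power :: "(lgraph \<Rightarrow> 'a::field) \<Rightarrow> lgraph list \<Rightarrow> 'a" where
  "tensor_power x Gs = prod_list (map x Gs)"

definition sym_decomp :: "nat \<Rightarrow> nat \<Rightarrow> (lgraph list \<Rightarrow> 'a::field) \<Rightarrow> nat \<Rightarrow> bool" where
  "sym_decomp k n T r \<longleftrightarrow>
     (\<exists>(c :: nat \<Rightarrow> 'a) x. (\<forall>i<r. x i \<in> PLG_functions k) \<and>
        (\<forall>Gs. length Gs = n \<longrightarrow> set Gs \<subseteq> PLG k \<longrightarrow>
           T Gs = (\<Sum>i<r. c i * tensor_power (x i) Gs)))"

text \<open>In \<open>enat\<close> the infimum of the empty set is \<open>\<infinity>\<close>.\<close>

definition sym_rank :: "nat \<Rightarrow> nat \<Rightarrow> (lgraph list \<Rightarrow> 'a::field) \<Rightarrow> enat" where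
  "sym_rank k n T = Inf {enat r |r. sym_decomp k n T r}"

end

theory Submission
  imports Defs "HOL-Combinatorics.Transposition"
begin

text \<open>For a finite label set \<open>S\<close>, a shortest symmetric decomposition of a tensor of high order writes \<open>f\<close> on
  \<open>S\<close>-labeled graphs as \<open>\<Sum>\<chi>\<in>X\<^sub>S. \<lambda>\<^sub>\<chi> \<chi>\<close> with nonzero coefficients and at most \<open>q ^ |S|\<close> multiplicative
  functions \<open>\<chi>\<close>, which are unique by Dedekind's independence of characters. For \<open>S \<subseteq> T\<close> restriction maps
  \<open>X\<^sub>T\<close> to \<open>X\<^sub>S\<close>, and \<open>\<lambda>\<^sub>\<psi> \<psi> H\<close> is the sum of \<open>\<lambda>\<^sub>\<chi> \<chi> H\<close> over the fiber of \<open>\<psi>\<close>. Comparing coefficients once more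
  shows that two characters over \<open>\<psi>\<close> for label sets meeting in \<open>S\<close> have a common extension. Hence if
  \<open>\<psi>\<close> has \<open>d\<close> extensions to one new label, it has at least \<open>d ^ m\<close> extensions to \<open>m\<close> new labels, which
  forces \<open>d \<le> q\<close>. For a \<open>\<psi>\<close> with \<open>d\<close> maximal, the extensions to a set \<open>W\<close> of new labels correspond exactly
  to the maps from \<open>W\<close> to a set of \<open>d\<close> vertices, and their coefficients are multiplicative. Labeling all
  nodes of a graph \<open>G\<close> by new labels turns the expansion of \<open>\<psi>\<close> into the formula for \<open>hom(G, H)\<close>.\<close>

section \<open>Labeled graphs and their characters\<close>

text \<open>Over an arbitrary field sums of coefficients may cancel, so extensions cannot be
  produced by positivity. They come from a product of two nonzero coefficients, which
  \<open>amalgamation\<close> equates with a multiple of the coefficient sum over all common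
  extensions. The tensor order used is a bound on the number of terms plus two: the powers left
  after removing two slots must still be independent, and the two slots compare a pair of factors
  with their product. Staying at the empty label set may not suffice. If \<open>f\<close> is
  \<open>hom\<close> into some weighted graph, vertices related by an automorphism give the same
  one-label character, so there can be fewer extensions than vertices; the labels in
  \<open>S\<close> break such symmetries. Maximality of \<psi> makes common extensions unique, so
  the sums over them collapse to single terms, and this is the source of multiplicative
  coefficients. The way back from \<psi> to \<open>f\<close> is that at most
  \<open>q ^ 0 = 1\<close> character exists for the empty label set; with \<open>f K0 = 1\<close> it
  is \<open>f\<close> itself, so \<psi> restricts to \<open>f\<close>.\<close>

text \<open>A graph labeled by a finite set \<open>S\<close> of natural numbers is encoded with the label of a node as
  the node itself. Forgetting labels is then the identity on graphs, and the product of two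
  \<open>S\<close>-labeled graphs that meet exactly in \<open>S\<close> is their union.\<close>

definition sgraph :: "nat set \<Rightarrow> mgraph \<Rightarrow> bool" where
  "sgraph S G \<longleftrightarrow> is_graph G \<and> S \<subseteq> verts G"

definition edgeless :: "nat set \<Rightarrow> mgraph" where
  "edgeless S = \<lparr>verts = S, edges = {#}\<rparr>"

definition gunion :: "mgraph \<Rightarrow> mgraph \<Rightarrow> mgraph" where
  "gunion G H = \<lparr>verts = verts G \<union> verts H, edges = edges G + edges H\<rparr>"

definition gmap :: "(nat \<Rightarrow> nat) \<Rightarrow> mgraph \<Rightarrow> mgraph" where
  "gmap \<pi> G = \<lparr>verts = \<pi> ` verts G, edges = image_mset (\<lambda>e. \<pi> ` e) (edges G)\<rparr>"

text \<open>Inserting \<open>0\<close> keeps the argument of \<open>Max\<close> nonempty when both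
  sets are empty.\<close>

definition shift :: "nat set \<Rightarrow> nat set \<Rightarrow> nat \<Rightarrow> nat" where
  "shift S T v = (if v \<in> S then v else v + Suc (Max (insert 0 (S \<union> T))))"

text \<open>Sorting fixes one enumeration of \<open>S\<close>, so that label sets of size
  \<open>k\<close> can be fed to the \<open>k\<close>-labeled setting.\<close>

definition lab :: "nat set \<Rightarrow> mgraph \<Rightarrow> lgraph" where
  "lab S G = \<lparr>verts = verts G, edges = edges G, labels = sorted_list_of_set S\<rparr>"

text \<open>The value \<open>0\<close> outside of the \<open>S\<close>-labeled graphs makes characters that agree on these graphs
  equal as functions.\<close>

definition character :: "nat set \<Rightarrow> (mgraph \<Rightarrow> 'a::field) \<Rightarrow> bool" where
  "character S \<chi> \<longleftrightarrow>
     (\<forall>G. \<not> sgraph S G \<longrightarrow> \<chi> G = 0) \<and> \<chi> (edgeless S) = 1 \<and>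
     (\<forall>G \<pi>. sgraph S G \<longrightarrow> inj_on \<pi> (verts G) \<longrightarrow> (\<forall>v\<in>S. \<pi> v = v) \<longrightarrow> \<chi> (gmap \<pi> G) = \<chi> G) \<and>
     (\<forall>G H. sgraph S G \<longrightarrow> sgraph S H \<longrightarrow> verts G \<inter> verts H = S \<longrightarrow> \<chi> (gunion G H) = \<chi> G * \<chi> H)"

section \<open>Operations on graphs labeled by a set\<close>

lemma verts_edgeless [simp]: "verts (edgeless S) = S"
  and edges_edgeless [simp]: "edges (edgeless S) = {#}"
  and verts_gunion [simp]: "verts (gunion G H) = verts G \<union> verts H"
  and edges_gunion [simp]: "edges (gunion G H) = edges G + edges H"
  and verts_gmap [simp]: "verts (gmap \<pi> G) = \<pi> ` verts G"
  and edges_gmap [simp]: "edges (gmap \<pi> G) = image_mset (\<lambda>e. \<pi> ` e) (edges G)"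
  and verts_lab [simp]: "verts (lab S G) = verts G"
  and edges_lab [simp]: "edges (lab S G) = edges G"
  and labels_lab [simp]: "labels (lab S G) = sorted_list_of_set S"
  by (simp_all add: edgeless_def gunion_def gmap_def lab_def)

lemma truncate_lab [simp]: "mgraph.truncate (lab S G) = G"
  by (simp add: lab_def mgraph.defs)

lemma truncate_sel [simp]: "edges (mgraph.truncate G) = edges G" "verts (mgraph.truncate G) = verts G"
  by (simp_all add: mgraph.defs)

lemma mgraph_eqI: "verts G = verts H \<Longrightarrow> edges G = edges H \<Longrightarrow> G = (H :: mgraph)"
  by simp

lemma is_graph_edgeless [simp]: "is_graph (edgeless S) \<longleftrightarrow> finite S"
  by (simp add: is_graph_def)

lemma is_graph_gunion [intro]: "is_graph G \<Longrightarrow> is_graph H \<Longrightarrow> is_graph (gunion G H)"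
  by (auto simp: is_graph_def)

lemma is_graph_gmap:
  assumes "is_graph G" "inj_on \<pi> (verts G)"
  shows "is_graph (gmap \<pi> G)"
  using assms by (auto simp: is_graph_def intro!: card_image intro: inj_on_subset)
    (metis card_image inj_on_subset)

lemma gmap_gmap: "gmap \<pi> (gmap \<rho> G) = gmap (\<pi> \<circ> \<rho>) G"
  by (simp add: gmap_def image_image multiset.map_comp comp_def)

lemma gmap_cong:
  assumes "is_graph G" "\<And>v. v \<in> verts G \<Longrightarrow> \<pi> v = \<rho> v"
  shows "gmap \<pi> G = gmap \<rho> G"
proof (rule mgraph_eqI)
  show "edges (gmap \<pi> G) = edges (gmap \<rho> G)"
    unfolding edges_gmap
  proof (rule image_mset_cong)
    fix e assume "e \<in># edges G"
    then have "e \<subseteq> verts G" using assms(1) by (auto simp: is_graph_def)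
    then show "\<pi> ` e = \<rho> ` e" using assms(2) by (intro image_cong) auto
  qed
qed (use assms(2) in auto)

lemma gmap_gunion: "gmap \<pi> (gunion G H) = gunion (gmap \<pi> G) (gmap \<pi> H)"
  by (auto intro!: mgraph_eqI)

lemma gmap_edgeless: "gmap \<pi> (edgeless S) = edgeless (\<pi> ` S)"
  by (auto intro!: mgraph_eqI)

lemma gunion_assoc: "gunion (gunion G H) K = gunion G (gunion H K)"
  by (auto intro!: mgraph_eqI)

lemma gunion_edgeless: "S \<subseteq> verts G \<Longrightarrow> gunion G (edgeless S) = G"
  by (auto intro!: mgraph_eqI)

lemma gunion_edgeless_left: "S \<subseteq> verts G \<Longrightarrow> gunion (edgeless S) G = G"
  by (auto intro!: mgraph_eqI)

lemma sgraph_finite: "sgraph S G \<Longrightarrow> finite (verts G)" "sgraph S G \<Longrightarrow> finite S"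
  by (auto simp: sgraph_def is_graph_def intro: finite_subset)

lemma sgraph_gunion: "sgraph S G \<Longrightarrow> is_graph H \<Longrightarrow> sgraph S (gunion G H)"
  by (auto simp: sgraph_def)

lemma sgraph_gunion_edgeless: "is_graph G \<Longrightarrow> finite T \<Longrightarrow> sgraph T (gunion G (edgeless T))"
  by (auto simp: sgraph_def)

lemma sgraph_mono: "sgraph T G \<Longrightarrow> S \<subseteq> T \<Longrightarrow> sgraph S G"
  by (auto simp: sgraph_def)

lemma sgraph_edgeless: "finite S \<Longrightarrow> sgraph S (edgeless S)"
  by (auto simp: sgraph_def)

lemma sgraph_gmap:
  assumes "sgraph S G" "inj_on \<pi> (verts G)" "\<forall>v\<in>S. \<pi> v = v"
  shows "sgraph S (gmap \<pi> G)"
proof -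
  have "S \<subseteq> \<pi> ` verts G" using assms(1,3) unfolding sgraph_def by force
  then show ?thesis using assms is_graph_gmap by (auto simp: sgraph_def)
qed

lemma shift_fixes: "v \<in> S \<Longrightarrow> shift S T v = v"
  by (simp add: shift_def)

lemma shift_gt:
  assumes "finite S" "finite T" "v \<notin> S" "w \<in> S \<union> T"
  shows "w < shift S T v"
proof -
  have "w \<le> Max (insert 0 (S \<union> T))" using assms by (intro Max_ge) auto
  then show ?thesis using assms(3) by (simp add: shift_def)
qed

lemma shift_avoids: "finite S \<Longrightarrow> finite T \<Longrightarrow> v \<notin> S \<Longrightarrow> shift S T v \<notin> S \<union> T"
  using shift_gt by blast

lemma inj_shift:
  assumes "finite S" "finite T" shows "inj (shift S T)"
proof (rule injI)
  fix v w assume eq: "shift S T v = shift S T w"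
  show "v = w"
  proof (cases "v \<in> S \<longleftrightarrow> w \<in> S")
    case True
    then show ?thesis using eq by (auto simp: shift_def)
  next
    case False
    then show ?thesis using eq shift_avoids[OF assms] by (metis UnCI shift_fixes)
  qed
qed

lemma verts_shift:
  assumes "sgraph S G" "finite T"
  shows "verts (gmap (shift S T) G) \<inter> T \<subseteq> S"
proof
  fix x assume "x \<in> verts (gmap (shift S T) G) \<inter> T"
  then obtain v where "x = shift S T v" "x \<in> T" by auto
  then show "x \<in> S" using shift_avoids[OF sgraph_finite(2)[OF assms(1)] assms(2)] shift_fixes
    by (metis Un_iff)
qed

lemma sgraph_shift: "sgraph S G \<Longrightarrow> finite T \<Longrightarrow> sgraph S (gmap (shift S T) G)"
  by (rule sgraph_gmap) (auto simp: shift_fixes sgraph_finite(2)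
      intro: inj_on_subset[OF inj_shift])

section \<open>Characters and their linear independence\<close>

lemma characterD:
  assumes "character S \<chi>"
  shows character_zero: "\<not> sgraph S G \<Longrightarrow> \<chi> G = 0"
    and character_one: "\<chi> (edgeless S) = 1"
    and character_gmap: "sgraph S G \<Longrightarrow> inj_on \<pi> (verts G) \<Longrightarrow> (\<And>v. v \<in> S \<Longrightarrow> \<pi> v = v) \<Longrightarrow> \<chi> (gmap \<pi> G) = \<chi> G"
    and character_mult: "sgraph S G \<Longrightarrow> sgraph S H \<Longrightarrow> verts G \<inter> verts H = S \<Longrightarrow> \<chi> (gunion G H) = \<chi> G * \<chi> H"
  using assms unfolding character_def by blast+

lemma character_shift:
  assumes "character S \<chi>" "sgraph S G" "finite T"
  shows "\<chi> (gmap (shift S T) G) = \<chi> G"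
  by (rule character_gmap[OF assms(1,2)])
    (use assms in \<open>auto simp: shift_fixes sgraph_finite(2) intro: inj_on_subset[OF inj_shift]\<close>)

text \<open>Both functions vanish off the \<open>S\<close>-labeled graphs, and every
  \<open>S\<close>-labeled graph has a shifted copy with the same values whose unlabeled nodes avoid
  \<open>T\<close>.\<close>

lemma character_eqI:
  assumes "character S \<chi>" "character S \<chi>'" "finite T"
    and "\<And>G. sgraph S G \<Longrightarrow> verts G \<inter> T \<subseteq> S \<Longrightarrow> \<chi> G = \<chi>' G"
  shows "\<chi> = \<chi>'"
proof
  fix G show "\<chi> G = \<chi>' G"
    using assms character_zero[OF assms(1)] character_zero[OF assms(2)]
      character_shift[OF assms(1)] character_shift[OF assms(2)] sgraph_shift verts_shift by metis
qed

text \<open>Dedekind's argument. It suffices to test on graphs whose unlabeled nodes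
  avoid \<open>T\<close>, because every \<open>S\<close>-labeled graph has an isomorphic copy of this kind.\<close>

lemma characters_independent:
  assumes "finite Y" "finite T" "finite S" "\<And>\<chi>. \<chi> \<in> Y \<Longrightarrow> character S \<chi>"
    and "\<And>G. sgraph S G \<Longrightarrow> verts G \<inter> T \<subseteq> S \<Longrightarrow> (\<Sum>\<chi>\<in>Y. c \<chi> * \<chi> G) = 0"
    and "\<chi> \<in> Y"
  shows "c \<chi> = 0"
proof -
  have gen: "(\<Sum>\<chi>\<in>Y. c \<chi> * \<chi> G) = 0" if G: "sgraph S G" for G
  proof -
    have "(\<Sum>\<chi>\<in>Y. c \<chi> * \<chi> G) = (\<Sum>\<chi>\<in>Y. c \<chi> * \<chi> (gmap (shift S T) G))"
      by (intro sum.cong) (simp_all add: character_shift[OF assms(4) G assms(2)])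
    also have "\<dots> = 0" by (intro assms(5) sgraph_shift verts_shift G assms(2))
    finally show ?thesis .
  qed
  from assms(1,4,6) gen show ?thesis
  proof (induction Y arbitrary: c \<chi> rule: finite_induct)
    case empty
    then show ?case by simp
  next
    case (insert \<phi> Y)
    have \<phi>: "character S \<phi>" by (rule insert.prems(1)) simp
    \<comment> \<open>The relation survives multiplication of each term by \<open>\<chi> A\<close>:
      the product of values is the value at the union of \<open>A\<close> with a copy of
      \<open>G\<close> that meets \<open>A\<close> only in \<open>S\<close>.\<close>
    have prod: "(\<Sum>\<chi>\<in>insert \<phi> Y. c \<chi> * (\<chi> A * \<chi> G)) = 0" if A: "sgraph S A" and G: "sgraph S G" for A G
    proof -
      let ?G = "gmap (shift S (verts A)) G"
      have G': "sgraph S ?G" "verts A \<inter> verts ?G = S"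
        using sgraph_shift[OF G] verts_shift[OF G] sgraph_finite[OF A] A
        unfolding sgraph_def by blast+
      have "\<chi> A * \<chi> G = \<chi> (gunion A ?G)" if "\<chi> \<in> insert \<phi> Y" for \<chi>
        using character_mult[OF insert.prems(1)[OF that] A G']
          character_shift[OF insert.prems(1)[OF that] G sgraph_finite(1)[OF A]] by simp
      then have "(\<Sum>\<chi>\<in>insert \<phi> Y. c \<chi> * (\<chi> A * \<chi> G)) = (\<Sum>\<chi>\<in>insert \<phi> Y. c \<chi> * \<chi> (gunion A ?G))"
        by (intro sum.cong refl) metis
      also have "\<dots> = 0"
        using insert.prems(3)[OF sgraph_gunion[OF A]] G'(1) unfolding sgraph_def by blast
      finally show ?thesis .
    qed
    have step: "c \<xi> = 0" if \<xi>: "\<xi> \<in> Y" for \<xi>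
    proof -
      have "\<xi> \<noteq> \<phi>" using \<xi> insert.hyps by auto
      then obtain A where A: "\<xi> A \<noteq> \<phi> A" by blast
      then have sA: "sgraph S A"
        using character_zero[OF insert.prems(1)] \<xi> by (metis insertCI)
      \<comment> \<open>Subtracting \<open>\<phi> A\<close> times the relation at \<open>G\<close>
        from the relation at the product of \<open>A\<close> and \<open>G\<close> cancels the term
        of \<phi> and leaves a relation on \<open>Y\<close>.\<close>
      have "c \<xi> * (\<xi> A - \<phi> A) = 0"
      proof (rule insert.IH[where c = "\<lambda>\<chi>. c \<chi> * (\<chi> A - \<phi> A)"])
        fix G assume G: "sgraph S G"
        have "(\<Sum>\<chi>\<in>Y. c \<chi> * (\<chi> A - \<phi> A) * \<chi> G)
            = (\<Sum>\<chi>\<in>Y. c \<chi> * (\<chi> A * \<chi> G)) - \<phi> A * (\<Sum>\<chi>\<in>Y. c \<chi> * \<chi> G)"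
          by (simp add: sum_distrib_left sum_subtractf[symmetric] algebra_simps)
        also have "\<dots> = (\<Sum>\<chi>\<in>insert \<phi> Y. c \<chi> * (\<chi> A * \<chi> G)) - \<phi> A * (\<Sum>\<chi>\<in>insert \<phi> Y. c \<chi> * \<chi> G)"
          using insert.hyps by (simp add: algebra_simps)
        also have "\<dots> = 0" using prod[OF sA G] insert.prems(3)[OF G] by simp
        finally show "(\<Sum>\<chi>\<in>Y. c \<chi> * (\<chi> A - \<phi> A) * \<chi> G) = 0" .
      qed (use \<xi> insert.prems(1) in auto)
      then show ?thesis using A by simp
    qed
    \<comment> \<open>With all other coefficients zero, the relation at the unit isolates
      \<open>c \<phi>\<close>.\<close>
    have "c \<phi> = (\<Sum>\<chi>\<in>insert \<phi> Y. c \<chi> * \<chi> (edgeless S))"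
      using insert.hyps step character_one[OF \<phi>] by simp
    also have "\<dots> = 0" by (rule insert.prems(3)[OF sgraph_edgeless[OF assms(3)]])
    finally show ?case using step insert.prems(2) by auto
  qed
qed

section \<open>Restriction of characters to fewer labels\<close>

text \<open>Two copies of \<open>G\<close> kept apart from the added labels differ by an injective
  renaming that fixes \<open>T\<close>, and characters ignore those. Hence \<open>restr\<close> does
  not depend on the copy chosen in its definition.\<close>

lemma character_padding:
  assumes \<chi>: "character T \<chi>" and G: "sgraph S G" and T: "S \<subseteq> T" "finite T"
    and \<rho>: "inj_on \<rho> (verts G)" "\<And>v. v \<in> S \<Longrightarrow> \<rho> v = v" "\<And>v. v \<in> verts G - S \<Longrightarrow> \<rho> v \<notin> T"
    and \<rho>': "inj_on \<rho>' (verts G)" "\<And>v. v \<in> S \<Longrightarrow> \<rho>' v = v" "\<And>v. v \<in> verts G - S \<Longrightarrow> \<rho>' v \<notin> T"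
  shows "\<chi> (gunion (gmap \<rho> G) (edgeless T)) = \<chi> (gunion (gmap \<rho>' G) (edgeless T))"
proof -
  \<comment> \<open>On \<open>T\<close> this is the identity, elsewhere it replaces
    \<open>\<rho> v\<close> by \<open>\<rho>' v\<close>; for nodes of \<open>S\<close> both
    prescriptions give the node itself.\<close>
  define \<tau> where "\<tau> x = (if x \<in> T then x else \<rho>' (inv_into (verts G) \<rho> x))" for x
  have \<tau>: "\<tau> (\<rho> v) = \<rho>' v" if "v \<in> verts G" for v
    using that \<rho> \<rho>' T by (cases "v \<in> S") (auto simp: \<tau>_def)
  have gr: "is_graph (gmap \<rho> G)" using G \<rho>(1) is_graph_gmap sgraph_def by blast
  have "inj_on \<tau> (\<rho> ` verts G \<union> T)"
  proof (rule inj_onI)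
    have *: "\<tau> x \<in> T \<longleftrightarrow> x \<in> T" if x: "x \<in> \<rho> ` verts G \<union> T" for x
    proof (cases "x \<in> T")
      case True then show ?thesis by (simp add: \<tau>_def)
    next
      case False
      then obtain v where "v \<in> verts G" "x = \<rho> v" using x by blast
      moreover have "v \<notin> S" using False calculation \<rho>(2) T by auto
      ultimately show ?thesis using False \<tau> \<rho>'(3) by auto
    qed
    fix x y assume xy: "x \<in> \<rho> ` verts G \<union> T" "y \<in> \<rho> ` verts G \<union> T" "\<tau> x = \<tau> y"
    show "x = y"
    proof (cases "x \<in> T")
      case True
      then have "y \<in> T" using * xy by metis
      then show ?thesis using True xy by (simp add: \<tau>_def)
    next
      case False
      then have "y \<notin> T" using * xy by metis
      then obtain v w where "v \<in> verts G" "x = \<rho> v" "w \<in> verts G" "y = \<rho> w" using False xy by blast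
      then show ?thesis using xy(3) \<tau> \<rho>'(1) by (metis inj_onD)
    qed
  qed
  then have "\<chi> (gmap \<tau> (gunion (gmap \<rho> G) (edgeless T))) = \<chi> (gunion (gmap \<rho> G) (edgeless T))"
    by (intro character_gmap[OF \<chi>] sgraph_gunion_edgeless gr T) (auto simp: \<tau>_def)
  moreover have "gmap \<tau> (gunion (gmap \<rho> G) (edgeless T)) = gunion (gmap \<rho>' G) (edgeless T)"
  proof -
    have "gmap \<tau> (gmap \<rho> G) = gmap \<rho>' G"
      unfolding gmap_gmap using G \<tau> by (intro gmap_cong) (auto simp: sgraph_def)
    moreover have "\<tau> ` T = T" by (auto simp: \<tau>_def)
    ultimately show ?thesis by (simp add: gmap_gunion gmap_edgeless)
  qed
  ultimately show ?thesis by simp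
qed

text \<open>The pullback of a \<open>T\<close>-character along the map that adds the nodes of \<open>T - S\<close> as isolated labeled
  nodes. The shift moves unlabeled nodes out of \<open>T\<close>.\<close>

definition restr :: "nat set \<Rightarrow> nat set \<Rightarrow> (mgraph \<Rightarrow> 'a::field) \<Rightarrow> mgraph \<Rightarrow> 'a" where
  "restr S T \<chi> G = (if sgraph S G then \<chi> (gunion (gmap (shift S T) G) (edgeless T)) else 0)"

lemma restr_gmap:
  assumes \<chi>: "character T \<chi>" and G: "sgraph S G" and T: "S \<subseteq> T" "finite T"
    and \<rho>: "inj_on \<rho> (verts G)" "\<And>v. v \<in> S \<Longrightarrow> \<rho> v = v" "\<And>v. v \<in> verts G - S \<Longrightarrow> \<rho> v \<notin> T"
  shows "restr S T \<chi> G = \<chi> (gunion (gmap \<rho> G) (edgeless T))"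
proof -
  have S: "finite S" using T finite_subset by blast
  show ?thesis
    unfolding restr_def using G
    by (auto intro!: character_padding[OF \<chi> G T _ _ _ \<rho>] inj_on_subset[OF inj_shift[OF S T(2)]]
        simp: shift_fixes dest: shift_avoids[OF S T(2)])
qed

lemma restr_eq:
  assumes \<chi>: "character T \<chi>" and G: "sgraph S G" and T: "S \<subseteq> T" "finite T"
    and V: "verts G \<inter> T \<subseteq> S"
  shows "restr S T \<chi> G = \<chi> (gunion G (edgeless T))"
proof -
  have "gmap (\<lambda>v. v) G = G" by (rule mgraph_eqI) auto
  moreover have "restr S T \<chi> G = \<chi> (gunion (gmap (\<lambda>v. v) G) (edgeless T))"
    using V by (intro restr_gmap[OF \<chi> G T]) auto
  ultimately show ?thesis by metis
qed

text \<open>Adding the isolated labels of \<open>T\<close> respects units, renamings and products: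
  padded copies of graphs that meet in \<open>S\<close> meet in exactly \<open>T\<close>.\<close>

lemma character_restr:
  assumes \<chi>: "character T \<chi>" and T: "S \<subseteq> T" "finite T"
  shows "character S (restr S T \<chi>)"
  unfolding character_def
proof (intro conjI allI impI)
  fix G assume "\<not> sgraph S G" then show "restr S T \<chi> G = 0" by (simp add: restr_def)
next
  have S: "finite S" using T finite_subset by blast
  have "gunion (edgeless S) (edgeless T) = edgeless T" using T by (intro gunion_edgeless_left) auto
  then show "restr S T \<chi> (edgeless S) = 1"
    using restr_eq[OF \<chi> sgraph_edgeless[OF S] T] character_one[OF \<chi>] by auto
next
  have S: "finite S" using T finite_subset by blast
  fix G \<pi> assume G: "sgraph S G" and \<pi>: "inj_on \<pi> (verts G)" "\<forall>v\<in>S. \<pi> v = v"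
  \<comment> \<open>An injective map fixing \<open>S\<close> cannot bring an unlabeled node into
    \<open>S\<close>, so following it by the shift again yields an admissible copy.\<close>
  have *: "\<pi> v \<notin> S" if "v \<in> verts G - S" for v
  proof
    assume "\<pi> v \<in> S"
    then have "\<pi> (\<pi> v) = \<pi> v" "\<pi> v \<in> verts G" using \<pi>(2) G by (auto simp: sgraph_def)
    then have "\<pi> v = v" using \<pi>(1) that by (meson DiffD1 inj_onD)
    then show False using that \<open>\<pi> v \<in> S\<close> by simp
  qed
  have "restr S T \<chi> G = \<chi> (gunion (gmap (shift S T \<circ> \<pi>) G) (edgeless T))"
  proof (rule restr_gmap[OF \<chi> G T])
    show "inj_on (shift S T \<circ> \<pi>) (verts G)"
      using \<pi>(1) inj_on_subset[OF inj_shift[OF S T(2)] subset_UNIV] by (rule comp_inj_on)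
    show "(shift S T \<circ> \<pi>) v = v" if "v \<in> S" for v using that \<pi> by (simp add: shift_fixes)
    show "(shift S T \<circ> \<pi>) v \<notin> T" if "v \<in> verts G - S" for v
      using shift_avoids[OF S T(2)] *[OF that] by simp
  qed
  also have "\<dots> = restr S T \<chi> (gmap \<pi> G)"
    using sgraph_gmap[OF G \<pi>] by (simp add: restr_def gmap_gmap)
  finally show "restr S T \<chi> (gmap \<pi> G) = restr S T \<chi> G" ..
next
  have S: "finite S" using T finite_subset by blast
  fix G H assume G: "sgraph S G" and H: "sgraph S H" and GH: "verts G \<inter> verts H = S"
  let ?s = "gmap (shift S T)" and ?T = "edgeless T"
  have s: "sgraph S (?s G)" "sgraph S (?s H)" using sgraph_shift G H T by auto
  have "shift S T ` S = S" by (simp add: shift_fixes)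
  then have "shift S T ` verts G \<inter> shift S T ` verts H = S"
    using image_Int[OF inj_shift[OF S T(2)], of "verts G" "verts H"] GH by simp
  then have V: "verts (gunion (?s G) ?T) \<inter> verts (gunion (?s H) ?T) = T" using T by auto
  have "restr S T \<chi> (gunion G H) = \<chi> (gunion (gunion (?s G) ?T) (gunion (?s H) ?T))"
    using sgraph_gunion[OF G] H
    by (auto simp: restr_def gmap_gunion sgraph_def intro!: arg_cong[of _ _ \<chi>] mgraph_eqI)
  also have "\<dots> = \<chi> (gunion (?s G) ?T) * \<chi> (gunion (?s H) ?T)"
    using s T by (intro character_mult[OF \<chi> _ _ V] sgraph_gunion_edgeless) (auto simp: sgraph_def)
  also have "\<dots> = restr S T \<chi> G * restr S T \<chi> H" using G H by (simp add: restr_def)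
  finally show "restr S T \<chi> (gunion G H) = restr S T \<chi> G * restr S T \<chi> H" .
qed

lemma restr_restr:
  assumes \<chi>: "character U \<chi>" and ST: "S \<subseteq> T" and TU: "T \<subseteq> U" and U: "finite U"
  shows "restr S T (restr T U \<chi>) = restr S U \<chi>"
proof (rule character_eqI[OF _ _ U])
  have T: "finite T" using TU U finite_subset by blast
  note \<chi>T = character_restr[OF \<chi> TU U]
  have SU: "S \<subseteq> U" using ST TU by auto
  show "character S (restr S T (restr T U \<chi>))" by (rule character_restr[OF \<chi>T ST T])
  show "character S (restr S U \<chi>)" by (rule character_restr[OF \<chi> SU U])
  fix G assume G: "sgraph S G" and V: "verts G \<inter> U \<subseteq> S"
  have "restr S T (restr T U \<chi>) G = restr T U \<chi> (gunion G (edgeless T))"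
    using V TU by (intro restr_eq[OF \<chi>T G ST T]) auto
  also have "\<dots> = \<chi> (gunion (gunion G (edgeless T)) (edgeless U))"
    using V ST G by (intro restr_eq[OF \<chi> sgraph_gunion_edgeless[OF _ T] TU U]) (auto simp: sgraph_def)
  also have "gunion (gunion G (edgeless T)) (edgeless U) = gunion G (edgeless U)"
    using TU by (auto intro!: mgraph_eqI)
  also have "\<chi> \<dots> = restr S U \<chi> G" by (rule restr_eq[OF \<chi> G SU U V, symmetric])
  finally show "restr S T (restr T U \<chi>) G = restr S U \<chi> G" .
qed

lemma restr_self:
  assumes "character S \<chi>" "finite S" shows "restr S S \<chi> = \<chi>"
  by (rule character_eqI[OF character_restr[OF assms(1) subset_refl assms(2)] assms(1), of "{}"])
    (use assms in \<open>auto simp: restr_eq gunion_edgeless sgraph_def\<close>)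

section \<open>Change of labels\<close>

definition pull :: "(nat \<Rightarrow> nat) \<Rightarrow> (mgraph \<Rightarrow> 'a) \<Rightarrow> mgraph \<Rightarrow> 'a" where
  "pull \<sigma> \<chi> G = \<chi> (gmap \<sigma> G)"

lemma pull_pull: "pull \<sigma> (pull \<tau> \<chi>) = pull (\<tau> \<circ> \<sigma>) \<chi>"
  by (simp add: pull_def gmap_gmap fun_eq_iff)

lemma gmap_inverse: "(\<And>v. \<tau> (\<sigma> v) = v) \<Longrightarrow> gmap \<tau> (gmap \<sigma> G) = G"
  by (auto simp: gmap_gmap image_image comp_def intro!: mgraph_eqI)

lemma pull_inverse: "(\<And>v. \<tau> (\<sigma> v) = v) \<Longrightarrow> pull \<sigma> (pull \<tau> \<chi>) = \<chi>"
  by (rule ext) (simp add: pull_def gmap_inverse)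

lemma inj_pull: "bij \<sigma> \<Longrightarrow> inj (pull \<sigma>)"
  by (rule inj_on_inverseI[of _ "pull (inv \<sigma>)"]) (simp add: pull_inverse bij_is_surj surj_f_inv_f)

lemma sgraph_gmap_bij:
  assumes "bij \<sigma>" shows "sgraph (\<sigma> ` S) (gmap \<sigma> G) \<longleftrightarrow> sgraph S G"
proof -
  have *: "is_graph (gmap \<tau> G)" if "is_graph G" "bij \<tau>" for \<tau> G
    using that is_graph_gmap inj_on_subset[of \<tau> UNIV] by (auto simp: bij_def)
  have "is_graph (gmap \<sigma> G) \<Longrightarrow> is_graph G"
    using *[of "gmap \<sigma> G" "inv \<sigma>"] assms by (simp add: bij_imp_bij_inv gmap_inverse bij_is_inj)
  then show ?thesis using * assms by (auto simp: sgraph_def bij_is_inj inj_image_subset_iff)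
qed

lemma character_pull:
  assumes \<chi>: "character (\<sigma> ` S) \<chi>" and \<sigma>: "bij \<sigma>"
  shows "character S (pull \<sigma> \<chi>)"
  unfolding character_def
proof (intro conjI allI impI)
  fix G assume "\<not> sgraph S G"
  then show "pull \<sigma> \<chi> G = 0"
    using character_zero[OF \<chi>] sgraph_gmap_bij[OF \<sigma>] by (simp add: pull_def)
next
  show "pull \<sigma> \<chi> (edgeless S) = 1" using character_one[OF \<chi>] by (simp add: pull_def gmap_edgeless)
next
  fix G \<pi> assume G: "sgraph S G" and \<pi>: "inj_on \<pi> (verts G)" "\<forall>v\<in>S. \<pi> v = v"
  \<comment> \<open>Conjugation turns a renaming that fixes \<open>S\<close> into one that fixes its
    image.\<close>
  let ?\<tau> = "\<sigma> \<circ> \<pi> \<circ> inv \<sigma>"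
  have "\<chi> (gmap ?\<tau> (gmap \<sigma> G)) = \<chi> (gmap \<sigma> G)"
  proof (rule character_gmap[OF \<chi>])
    show "sgraph (\<sigma> ` S) (gmap \<sigma> G)" using G sgraph_gmap_bij[OF \<sigma>] by simp
    show "inj_on ?\<tau> (verts (gmap \<sigma> G))"
    proof (rule inj_onI)
      fix x y assume *: "x \<in> verts (gmap \<sigma> G)" "y \<in> verts (gmap \<sigma> G)" "?\<tau> x = ?\<tau> y"
      then obtain v w where "v \<in> verts G" "x = \<sigma> v" "w \<in> verts G" "y = \<sigma> w"
        unfolding verts_gmap by blast
      then show "x = y" using *(3) \<pi>(1) \<sigma> by (simp add: bij_is_inj inj_eq inj_on_eq_iff)
    qed
    show "?\<tau> v = v" if "v \<in> \<sigma> ` S" for v using that \<pi> \<sigma> by (auto simp: bij_is_inj)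
  qed
  moreover have "gmap ?\<tau> (gmap \<sigma> G) = gmap \<sigma> (gmap \<pi> G)"
    using \<sigma> by (simp add: gmap_gmap comp_def bij_is_inj)
  ultimately show "pull \<sigma> \<chi> (gmap \<pi> G) = pull \<sigma> \<chi> G" by (simp add: pull_def)
next
  fix G H assume G: "sgraph S G" "sgraph S H" "verts G \<inter> verts H = S"
  have "\<sigma> ` verts G \<inter> \<sigma> ` verts H = \<sigma> ` S"
    using image_Int[OF bij_is_inj[OF \<sigma>], of "verts G" "verts H"] G by simp
  then show "pull \<sigma> \<chi> (gunion G H) = pull \<sigma> \<chi> G * pull \<sigma> \<chi> H"
    using G character_mult[OF \<chi>] sgraph_gmap_bij[OF \<sigma>] by (simp add: pull_def gmap_gunion)
qed

lemma restr_pull: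
  assumes \<chi>: "character (\<sigma> ` T) \<chi>" and \<sigma>: "bij \<sigma>" and T: "S \<subseteq> T" "finite T"
  shows "restr S T (pull \<sigma> \<chi>) = pull \<sigma> (restr (\<sigma> ` S) (\<sigma> ` T) \<chi>)"
proof -
  have *: "\<sigma> ` S \<subseteq> \<sigma> ` T" "finite (\<sigma> ` T)" using T by auto
  show ?thesis
  proof (rule character_eqI[OF character_restr[OF character_pull[OF \<chi> \<sigma>] T]
        character_pull[OF character_restr[OF \<chi> *] \<sigma>] T(2)])
    fix G assume G: "sgraph S G" "verts G \<inter> T \<subseteq> S"
    have V: "verts (gmap \<sigma> G) \<inter> \<sigma> ` T \<subseteq> \<sigma> ` S"
      using image_Int[OF bij_is_inj[OF \<sigma>], of "verts G" T] G(2) by auto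
    show "restr S T (pull \<sigma> \<chi>) G = pull \<sigma> (restr (\<sigma> ` S) (\<sigma> ` T) \<chi>) G"
      using restr_eq[OF character_pull[OF \<chi> \<sigma>] G(1) T G(2)]
        restr_eq[OF \<chi> _ * V] sgraph_gmap_bij[OF \<sigma>, of S G] G(1)
      by (simp add: pull_def gmap_gunion gmap_edgeless)
  qed
qed

text \<open>\<open>\<sigma>' \<circ> inv \<sigma>\<close> fixes \<open>T\<close>, so only the action
  on labels matters; what a bijection does to the unlabeled nodes is invisible to a
  character.\<close>

lemma pull_cong:
  assumes \<chi>: "character T \<chi>" and \<sigma>: "bij \<sigma>" "bij \<sigma>'" and "\<sigma> ` S = T"
    and eq: "\<And>v. v \<in> S \<Longrightarrow> \<sigma> v = \<sigma>' v"
  shows "pull \<sigma> \<chi> = pull \<sigma>' \<chi>"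
proof
  fix G
  have S': "\<sigma>' ` S = T" using assms by (metis image_cong)
  show "pull \<sigma> \<chi> G = pull \<sigma>' \<chi> G"
  proof (cases "sgraph S G")
    case False
    then show ?thesis
      using sgraph_gmap_bij[OF \<sigma>(1), of S G] sgraph_gmap_bij[OF \<sigma>(2), of S G] assms(4) S'
        character_zero[OF \<chi>] by (simp add: pull_def)
  next
    case True
    let ?\<tau> = "\<sigma>' \<circ> inv \<sigma>"
    have "\<chi> (gmap ?\<tau> (gmap \<sigma> G)) = \<chi> (gmap \<sigma> G)"
    proof (rule character_gmap[OF \<chi>])
      show "sgraph T (gmap \<sigma> G)" using True sgraph_gmap_bij[OF \<sigma>(1), of S G] assms(4) by simp
      have "bij ?\<tau>" by (intro bij_comp bij_imp_bij_inv \<sigma>)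
      then show "inj_on ?\<tau> (verts (gmap \<sigma> G))" using bij_is_inj inj_on_subset by blast
      show "?\<tau> v = v" if v: "v \<in> T" for v
      proof -
        obtain w where "w \<in> S" "v = \<sigma> w" using v assms(4) by blast
        moreover from this have "inv \<sigma> v = w" using \<sigma> by (simp add: bij_is_inj)
        ultimately show ?thesis using eq by simp
      qed
    qed
    then show ?thesis using \<sigma> by (simp add: pull_def gmap_gmap comp_def bij_is_inj)
  qed
qed

section \<open>Characters from a symmetric decomposition\<close>

text \<open>Contracting one slot with a functional that kills one function but not a chosen other
  one lowers both the order and the number of terms by one; \<open>card I \<le> n\<close> provides
  enough slots.\<close>

lemma tensor_powers_independent:
  fixes x :: "'i \<Rightarrow> 'b \<Rightarrow> 'a::field"
  assumes "finite I" "card I \<le> n"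
    and "\<And>i. i \<in> I \<Longrightarrow> \<exists>a\<in>M. x i a \<noteq> 0"
    and "\<And>i j. i \<in> I \<Longrightarrow> j \<in> I \<Longrightarrow> i \<noteq> j \<Longrightarrow> \<exists>a\<in>M. \<exists>b\<in>M. x i a * x j b \<noteq> x i b * x j a"
    and "\<And>as. length as = n \<Longrightarrow> set as \<subseteq> M \<Longrightarrow> (\<Sum>i\<in>I. c i * prod_list (map (x i) as)) = 0"
    and "i \<in> I"
  shows "c i = 0"
  using assms
proof (induction I arbitrary: c n i rule: finite_induct)
  case empty
  then show ?case by simp
next
  case (insert j J)
  obtain m where n: "n = Suc m" and m: "card J \<le> m"
    using insert.prems(1) insert.hyps by (cases n) auto
  have step: "c k = 0" if k: "k \<in> J" for k
  proof -
    have "k \<noteq> j" using k insert.hyps by auto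
    then obtain a b where ab: "a \<in> M" "b \<in> M" "x k a * x j b \<noteq> x k b * x j a"
      using insert.prems(3)[of k j] k by blast
    \<comment> \<open>The first slot receives \<open>a\<close> with weight \<open>x j b\<close> and
      \<open>b\<close> with weight \<open>- x j a\<close>; the term of \<open>j\<close> disappears
      and that of \<open>k\<close> gets a nonzero factor.\<close>
    have "c k * (x k a * x j b - x k b * x j a) = 0"
    proof (rule insert.IH[where c = "\<lambda>i. c i * (x i a * x j b - x i b * x j a)" and n = m])
      fix as assume as: "length as = m" "set as \<subseteq> M"
      have *: "(\<Sum>i\<in>insert j J. c i * (x i d * prod_list (map (x i) as))) = 0" if "d \<in> M" for d
        using insert.prems(4)[of "d # as"] that as n by simp
      let ?P = "\<lambda>i. prod_list (map (x i) as)"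
      have "(\<Sum>i\<in>J. c i * (x i a * x j b - x i b * x j a) * ?P i)
          = (\<Sum>i\<in>insert j J. c i * (x i a * x j b - x i b * x j a) * ?P i)"
        using insert.hyps by simp
      also have "\<dots> = x j b * (\<Sum>i\<in>insert j J. c i * (x i a * ?P i)) - x j a * (\<Sum>i\<in>insert j J. c i * (x i b * ?P i))"
        unfolding sum_distrib_left sum_subtractf[symmetric]
        by (intro sum.cong) (simp_all add: algebra_simps)
      also have "\<dots> = 0" using * ab by simp
      finally show "(\<Sum>i\<in>J. c i * (x i a * x j b - x i b * x j a) * ?P i) = 0" .
    qed (use m k insert.prems(2,3) in auto)
    then show ?thesis using ab(3) by simp
  qed
  have "c j = 0"
  proof -
    obtain a where a: "a \<in> M" "x j a \<noteq> 0" using insert.prems(2) by blast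
    \<comment> \<open>Only the term of \<open>j\<close> is left, tested on \<open>n\<close> copies
      of a point where \<open>x j\<close> does not vanish.\<close>
    have "c j * x j a ^ n = (\<Sum>i\<in>insert j J. c i * prod_list (map (x i) (replicate n a)))"
      using insert.hyps step by (simp add: prod_list_replicate)
    also have "\<dots> = 0" using a by (intro insert.prems(4)) auto
    finally show ?thesis using a by simp
  qed
  then show ?case using step insert.prems(5) by auto
qed

lemma prod_list_map_scale:
  fixes x y :: "'b \<Rightarrow> 'a::field"
  assumes "\<And>a. a \<in> set as \<Longrightarrow> x a = t * y a"
  shows "prod_list (map x as) = t ^ length as * prod_list (map y as)"
  using assms by (induction as) auto

text \<open>A decomposition of the tensor \<open>(a\<^sub>1, \<dots>, a\<^sub>n) \<mapsto> f (a\<^sub>1 \<cdots> a\<^sub>n)\<close> with fewest terms consists of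
  multiples of powers of characters: comparing the value at \<open>(a, b, \<dots>)\<close> with that at
  \<open>(ab, 1, \<dots>)\<close>, the independence of the \<open>(n - 2)\<close>-th powers gives
  \<open>x a * x b = x (ab) * x 1\<close> for each of the functions \<open>x\<close>.\<close>

lemma decomposition_characters:
  fixes T :: "'b list \<Rightarrow> 'a::field"
  assumes rm: "r \<le> m"
    and T: "\<And>as. length as = Suc (Suc m) \<Longrightarrow> set as \<subseteq> M \<Longrightarrow> T as = (\<Sum>i<r. c i * prod_list (map (x i) as))"
    and M: "e \<in> M" "\<And>a b. a \<in> M \<Longrightarrow> b \<in> M \<Longrightarrow> tms a b \<in> M"
    and assoc: "\<And>a b as. a \<in> M \<Longrightarrow> b \<in> M \<Longrightarrow> length as = m \<Longrightarrow> set as \<subseteq> M \<Longrightarrow> T (a # b # as) = T (tms a b # e # as)"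
  obtains I l where "I \<subseteq> {..<r}" "\<And>i. i \<in> I \<Longrightarrow> l i \<noteq> 0" "\<And>i. i \<in> I \<Longrightarrow> x i e \<noteq> 0"
    "\<And>i a b. i \<in> I \<Longrightarrow> a \<in> M \<Longrightarrow> b \<in> M \<Longrightarrow> x i (tms a b) * x i e = x i a * x i b"
    "\<And>i j. i \<in> I \<Longrightarrow> j \<in> I \<Longrightarrow> i \<noteq> j \<Longrightarrow> \<exists>a\<in>M. x i a / x i e \<noteq> x j a / x j e"
    "\<And>a. a \<in> M \<Longrightarrow> T (a # replicate (Suc m) e) = (\<Sum>i\<in>I. l i * (x i a / x i e))"
proof -
  let ?n = "Suc (Suc m)"
  \<comment> \<open>Only subfamilies of the given functions compete, with free coefficients. This
    class is closed under the two reductions needed: deleting a vanishing term and merging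
    proportional ones.\<close>
  define P where "P I \<longleftrightarrow> I \<subseteq> {..<r} \<and> (\<exists>c. \<forall>as. length as = ?n \<longrightarrow> set as \<subseteq> M \<longrightarrow>
      T as = (\<Sum>i\<in>I. c i * prod_list (map (x i) as)))" for I
  have "P {..<r}" unfolding P_def using T by auto
  then obtain I where PI: "P I" and min: "\<And>J. P J \<Longrightarrow> card I \<le> card J"
    using ex_has_least_nat[of P "{..<r}" card] by blast
  from PI obtain c where I: "I \<subseteq> {..<r}"
    and c: "\<And>as. length as = ?n \<Longrightarrow> set as \<subseteq> M \<Longrightarrow> T as = (\<Sum>i\<in>I. c i * prod_list (map (x i) as))"
    unfolding P_def by auto
  have finI: "finite I" using I finite_subset by blast
  have rem: "\<not> P (I - {i})" if "i \<in> I" for i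
    using min[of "I - {i}"] card_Diff1_less[OF finI that] by auto
  have drop: False if "i \<in> I" and z: "\<And>as. length as = ?n \<Longrightarrow> set as \<subseteq> M \<Longrightarrow> c i * prod_list (map (x i) as) = 0" for i
  proof -
    have "T as = (\<Sum>k\<in>I - {i}. c k * prod_list (map (x k) as))"
      if "length as = ?n" "set as \<subseteq> M" for as
      using c[OF that] z[OF that] sum.remove[OF finI \<open>i \<in> I\<close>, of "\<lambda>k. c k * prod_list (map (x k) as)"]
      by simp
    then show False using rem[OF \<open>i \<in> I\<close>] I unfolding P_def by blast
  qed
  have cnz: "c i \<noteq> 0" if "i \<in> I" for i using drop[OF that] by fastforce
  have xnz: "\<exists>a\<in>M. x i a \<noteq> 0" if "i \<in> I" for i
  proof (rule ccontr)
    assume *: "\<not> ?thesis"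
    show False
    proof (rule drop[OF that])
      fix as assume "length as = ?n" "set as \<subseteq> M"
      then show "c i * prod_list (map (x i) as) = 0" using * by (cases as) auto
    qed
  qed
  have nonprop: "\<exists>a\<in>M. \<exists>b\<in>M. x i a * x j b \<noteq> x i b * x j a" if ij: "i \<in> I" "j \<in> I" "i \<noteq> j" for i j
  proof (rule ccontr)
    assume *: "\<not> ?thesis"
    obtain b where b: "b \<in> M" "x j b \<noteq> 0" using xnz ij by blast
    define t where "t = x i b / x j b"
    have t: "x i a = t * x j a" if "a \<in> M" for a
      using * that b by (simp add: t_def divide_simps)
    \<comment> \<open>If \<open>x i\<close> is \<open>t\<close> times \<open>x j\<close>, its power
      of order \<open>?n\<close> is \<open>t ^ ?n\<close> times that of \<open>x j\<close>, so the
      term of \<open>i\<close> merges into that of \<open>j\<close>.\<close>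
    define c' where "c' = c(j := c j + c i * t ^ ?n)"
    have "T as = (\<Sum>k\<in>I - {i}. c' k * prod_list (map (x k) as))"
      if as: "length as = ?n" "set as \<subseteq> M" for as
    proof -
      let ?p = "\<lambda>k. prod_list (map (x k) as)"
      have pi: "?p i = t ^ ?n * ?p j" using prod_list_map_scale[of as "x i" t "x j"] t as by auto
      have jI: "j \<in> I - {i}" using ij by auto
      have "T as = c i * ?p i + (c j * ?p j + (\<Sum>k\<in>I - {i} - {j}. c k * ?p k))"
        using c[OF as] sum.remove[OF finI ij(1), of "\<lambda>k. c k * ?p k"]
          sum.remove[OF _ jI, of "\<lambda>k. c k * ?p k"] finI by simp
      also have "\<dots> = c' j * ?p j + (\<Sum>k\<in>I - {i} - {j}. c' k * ?p k)"
        unfolding pi by (simp add: c'_def algebra_simps)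
      also have "\<dots> = (\<Sum>k\<in>I - {i}. c' k * ?p k)"
        using sum.remove[OF _ jI, of "\<lambda>k. c' k * ?p k"] finI by simp
      finally show ?thesis .
    qed
    then show False using rem[OF ij(1)] I unfolding P_def by blast
  qed
  have cardI: "card I \<le> m" using card_mono[OF _ I] rm by simp
  have mult: "x i (tms a b) * x i e = x i a * x i b" if "i \<in> I" "a \<in> M" "b \<in> M" for i a b
  proof -
    have "c i * (x i a * x i b - x i (tms a b) * x i e) = 0"
    proof (rule tensor_powers_independent[where I = I and M = M and n = m and x = x
            and c = "\<lambda>i. c i * (x i a * x i b - x i (tms a b) * x i e)"])
      fix as assume as: "length as = m" "set as \<subseteq> M"
      let ?p = "\<lambda>k. prod_list (map (x k) as)"
      have "(\<Sum>i\<in>I. c i * (x i a * x i b - x i (tms a b) * x i e) * ?p i)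
          = (\<Sum>i\<in>I. c i * prod_list (map (x i) (a # b # as))) - (\<Sum>i\<in>I. c i * prod_list (map (x i) (tms a b # e # as)))"
        unfolding sum_subtractf[symmetric] by (intro sum.cong) (simp_all add: algebra_simps)
      also have "\<dots> = T (a # b # as) - T (tms a b # e # as)"
        using c[of "a # b # as"] c[of "tms a b # e # as"] as that M by simp
      also have "\<dots> = 0" using assoc[OF that(2,3) as] by simp
      finally show "(\<Sum>i\<in>I. c i * (x i a * x i b - x i (tms a b) * x i e) * ?p i) = 0" .
    qed (use finI cardI xnz nonprop that in auto)
    then show ?thesis using cnz that by simp
  qed
  \<comment> \<open>A zero at the unit would make every square \<open>x i a * x i a\<close>
    vanish.\<close>
  have enz: "x i e \<noteq> 0" if i: "i \<in> I" for i
  proof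
    assume "x i e = 0"
    moreover obtain a where "a \<in> M" "x i a \<noteq> 0" using xnz[OF i] by blast
    ultimately show False using mult[of i a a] i by simp
  qed
  \<comment> \<open>Dividing each of the \<open>?n\<close> factors by \<open>x i e\<close> makes the
    functions take the value \<open>1\<close> at the unit; the coefficient absorbs
    \<open>x i e ^ ?n\<close>.\<close>
  show ?thesis
  proof (rule that[of I "\<lambda>i. c i * x i e ^ ?n"])
    fix i j assume ij: "i \<in> I" "j \<in> I" "i \<noteq> j"
    show "\<exists>a\<in>M. x i a / x i e \<noteq> x j a / x j e"
    proof (rule ccontr)
      assume "\<not> ?thesis"
      then have *: "x i a = x i e / x j e * x j a" if "a \<in> M" for a
        using that enz[OF ij(1)] enz[OF ij(2)] by (auto simp: field_simps)
      obtain a b where ab: "a \<in> M" "b \<in> M" "x i a * x j b \<noteq> x i b * x j a"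
        using nonprop[OF ij] by blast
      show False using ab(3) *[OF ab(1)] *[OF ab(2)] by simp
    qed
  next
    fix a assume a: "a \<in> M"
    have "T (a # replicate (Suc m) e) = (\<Sum>i\<in>I. c i * prod_list (map (x i) (a # replicate (Suc m) e)))"
      using a M by (intro c) auto
    also have "\<dots> = (\<Sum>i\<in>I. c i * x i e ^ ?n * (x i a / x i e))"
      using enz by (intro sum.cong) (simp_all add: prod_list_replicate)
    finally show "T (a # replicate (Suc m) e) = (\<Sum>i\<in>I. c i * x i e ^ ?n * (x i a / x i e))" .
  qed (use I cnz enz mult in auto)
qed

section \<open>The product of labeled graphs as a union\<close>

lemma glue_name_nth:
  assumes "distinct ls" "i < length ls"
  shows "glue_name ls c (ls ! i) = i"
proof -
  have "takeWhile (\<lambda>w. w \<noteq> ls ! i) ls = take i ls"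
    using assms by (intro takeWhile_eq_take_P_nth) (auto simp: nth_eq_iff_index_eq)
  then show ?thesis using assms by (simp add: glue_name_def)
qed

lemma glue_name_unlabeled: "v \<notin> set ls \<Longrightarrow> glue_name ls c v = length ls + 2 * v + c"
  by (simp add: glue_name_def)

lemma glue_name_less_iff: "distinct ls \<Longrightarrow> glue_name ls c v < length ls \<longleftrightarrow> v \<in> set ls"
  by (cases "v \<in> set ls") (auto simp: in_set_conv_nth glue_name_nth glue_name_unlabeled)

lemma nth_glue_name: "distinct ls \<Longrightarrow> v \<in> set ls \<Longrightarrow> ls ! glue_name ls c v = v"
  by (metis glue_name_nth in_set_conv_nth)

lemma inj_glue_name:
  assumes "distinct ls" shows "inj (glue_name ls c)"
proof (rule injI)
  fix v w assume eq: "glue_name ls c v = glue_name ls c w"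
  show "v = w"
  proof (cases "v \<in> set ls")
    case True
    then have "w \<in> set ls" using glue_name_less_iff[OF assms] eq by metis
    then show ?thesis using True nth_glue_name[OF assms] eq by metis
  next
    case False
    then have "w \<notin> set ls" using glue_name_less_iff[OF assms] eq by metis
    then show ?thesis using False eq by (simp add: glue_name_unlabeled)
  qed
qed

lemma glue_name_labels: "distinct ls \<Longrightarrow> map (glue_name ls c) ls = [0..<length ls]"
  by (rule nth_equalityI) (auto simp: glue_name_nth)

lemma lprod_sel [simp]:
  "verts (lprod A B) = glue_name (labels A) 0 ` verts A \<union> glue_name (labels B) 1 ` verts B"
  "edges (lprod A B) = image_mset (\<lambda>e. glue_name (labels A) 0 ` e) (edges A) +
     image_mset (\<lambda>e. glue_name (labels B) 1 ` e) (edges B)"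
  "labels (lprod A B) = [0..<length (labels A)]"
  by (simp_all add: lprod_def Let_def)

lemma PLG_D:
  assumes "A \<in> PLG k"
  shows "is_graph A" "length (labels A) = k" "distinct (labels A)" "set (labels A) \<subseteq> verts A" "finite (verts A)"
  using assms by (auto simp: PLG_def is_graph_def)

lemma lprod_PLG:
  assumes "A \<in> PLG k" "B \<in> PLG k" shows "lprod A B \<in> PLG k"
proof -
  note A = PLG_D[OF assms(1)] and B = PLG_D[OF assms(2)]
  have "card (glue_name (labels A) 0 ` e) = 2" if "e \<in># edges A" for e
    using that A inj_on_subset[OF inj_glue_name[OF A(3)]] by (auto simp: is_graph_def card_image)
  moreover have "card (glue_name (labels B) 1 ` e) = 2" if "e \<in># edges B" for e
    using that B inj_on_subset[OF inj_glue_name[OF B(3)]] by (auto simp: is_graph_def card_image)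
  ultimately have "is_graph (lprod A B)"
    using A(1,5) B(1,5) unfolding is_graph_def lprod_sel set_mset_union set_image_mset by blast
  moreover have "glue_name (labels A) 0 ` set (labels A) = {..<k}"
    using glue_name_labels[OF A(3), of 0] A(2) by (metis atLeast_upt image_set lessThan_atLeast0)
  then have "{..<k} \<subseteq> glue_name (labels A) 0 ` verts A" using A(4) by (metis image_mono)
  ultimately show ?thesis using A(2) by (auto simp: PLG_def)
qed

lemma U_graph_PLG: "U_graph k \<in> PLG k"
  by (auto simp: PLG_def U_graph_def is_graph_def)

lemma lab_PLG: "sgraph S G \<Longrightarrow> card S = k \<Longrightarrow> lab S G \<in> PLG k"
  using sgraph_finite[of S G] by (auto simp: PLG_def sgraph_def is_graph_def)

lemma labeled_iso_U_graph:
  assumes "finite S" "card S = k" shows "labeled_iso (U_graph k) (lab S (edgeless S))"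
proof -
  have "bij_betw ((!) (sorted_list_of_set S)) {..<k} S"
    using bij_betw_nth[of "sorted_list_of_set S" "{..<k}" S] assms by auto
  moreover have "map ((!) (sorted_list_of_set S)) [0..<k] = sorted_list_of_set S"
    using assms map_nth[of "sorted_list_of_set S"] by simp
  ultimately show ?thesis
    unfolding labeled_iso_def graph_iso_def U_graph_def by auto
qed

text \<open>Nodes of the product coincide exactly at equal label positions, nodes of the union
  exactly in \<open>S\<close>, and both isomorphisms send position \<open>i\<close> to the
  \<open>i\<close>-th element of \<open>S\<close>. They therefore glue.\<close>

lemma labeled_iso_lprod:
  assumes S: "finite S" and A: "A \<in> PLG k" and B: "B \<in> PLG k"
    and AG: "labeled_iso A (lab S G)" and BH: "labeled_iso B (lab S H)"
    and GH: "verts G \<inter> verts H = S"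
  shows "labeled_iso (lprod A B) (lab S (gunion G H))"
proof -
  note A' = PLG_D[OF A] and B' = PLG_D[OF B]
  let ?ls = "sorted_list_of_set S" and ?a = "glue_name (labels A) 0" and ?b = "glue_name (labels B) 1"
  obtain \<pi> where \<pi>: "bij_betw \<pi> (verts A) (verts G)" "edges G = image_mset (\<lambda>e. \<pi> ` e) (edges A)" "map \<pi> (labels A) = ?ls"
    using AG by (auto simp: labeled_iso_def graph_iso_def)
  obtain \<rho> where \<rho>: "bij_betw \<rho> (verts B) (verts H)" "edges H = image_mset (\<lambda>e. \<rho> ` e) (edges B)" "map \<rho> (labels B) = ?ls"
    using BH by (auto simp: labeled_iso_def graph_iso_def)
  have sS: "set ?ls = S" using S by simp
  have lk: "length ?ls = k" using \<pi>(3) A'(2) by (metis length_map)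
  have \<pi>i: "\<pi> (labels A ! i) = ?ls ! i" if "i < k" for i using that \<pi>(3) A'(2) by (metis nth_map)
  have \<rho>i: "\<rho> (labels B ! i) = ?ls ! i" if "i < k" for i using that \<rho>(3) B'(2) by (metis nth_map)
  have a_lt: "?a v < k \<longleftrightarrow> v \<in> set (labels A)" for v using glue_name_less_iff[OF A'(3)] A'(2) by metis
  have b_lt: "?b v < k \<longleftrightarrow> v \<in> set (labels B)" for v using glue_name_less_iff[OF B'(3)] B'(2) by metis
  \<comment> \<open>Names of unlabeled nodes from different factors differ in parity relative to
    \<open>k\<close>, and labeled names lie below \<open>k\<close>; a coincidence is a label
    position.\<close>
  have ab: "?a v < k" "?b w < k" if eq: "?a v = ?b w" for v w
  proof -
    have "v \<in> set (labels A) \<or> w \<in> set (labels B)"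
    proof (rule ccontr)
      assume "\<not> ?thesis"
      then have "2 * v = 2 * w + 1" using eq A'(2) B'(2) by (simp add: glue_name_unlabeled)
      then show False by presburger
    qed
    then show "?a v < k" "?b w < k" using a_lt b_lt eq by metis+
  qed
  define \<tau> where "\<tau> x = (if x \<in> ?a ` verts A then \<pi> (inv ?a x) else \<rho> (inv ?b x))" for x
  have \<tau>a: "\<tau> (?a v) = \<pi> v" if "v \<in> verts A" for v
    using that inv_f_f[OF inj_glue_name[OF A'(3)]] by (simp add: \<tau>_def)
  have \<tau>b: "\<tau> (?b w) = \<rho> w" if w: "w \<in> verts B" for w
  proof (cases "?b w \<in> ?a ` verts A")
    case True
    then obtain v where v: "v \<in> verts A" "?a v = ?b w" by force
    have "labels A ! ?a v = v" "labels B ! ?b w = w"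
      using ab[OF v(2)] a_lt b_lt nth_glue_name A'(3) B'(3) by metis+
    then have "\<pi> v = \<rho> w" using ab[OF v(2)] \<pi>i \<rho>i v(2) by metis
    then show ?thesis using \<tau>a[OF v(1)] v(2) by simp
  next
    case False
    then show ?thesis using inv_f_f[OF inj_glue_name[OF B'(3)]] by (simp add: \<tau>_def)
  qed
  \<comment> \<open>Converse of the previous analysis, needed for injectivity: a node shared by
    \<open>G\<close> and \<open>H\<close> lies in \<open>S\<close>, so it comes from the same label
    position on both sides.\<close>
  have cross: "?a v = ?b w" if vw: "v \<in> verts A" "w \<in> verts B" "\<pi> v = \<rho> w" for v w
  proof -
    have "\<pi> v \<in> verts G" "\<rho> w \<in> verts H"
      using vw(1,2) bij_betwE[OF \<pi>(1)] bij_betwE[OF \<rho>(1)] by blast+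
    then have "\<pi> v \<in> S" using vw(3) GH by (metis IntI)
    then obtain i where i: "i < k" "\<pi> v = ?ls ! i" using sS lk by (metis in_set_conv_nth)
    have "labels A ! i \<in> verts A" "labels B ! i \<in> verts B"
      using A' B' i by (metis nth_mem subsetD)+
    moreover have "\<pi> v = \<pi> (labels A ! i)" "\<rho> w = \<rho> (labels B ! i)" using vw(3) i \<pi>i \<rho>i by simp_all
    ultimately have "v = labels A ! i" "w = labels B ! i"
      using vw(1,2) inj_onD[OF bij_betw_imp_inj_on[OF \<pi>(1)]] inj_onD[OF bij_betw_imp_inj_on[OF \<rho>(1)]]
      by blast+
    then show ?thesis using glue_name_nth A' B' i by metis
  qed
  have inj: "inj_on \<tau> (?a ` verts A \<union> ?b ` verts B)"
  proof (rule inj_onI)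
    fix x y assume xy: "x \<in> ?a ` verts A \<union> ?b ` verts B" "y \<in> ?a ` verts A \<union> ?b ` verts B" "\<tau> x = \<tau> y"
    have \<pi>inj: "v = w" if "v \<in> verts A" "w \<in> verts A" "\<pi> v = \<pi> w" for v w
      using that \<pi>(1) by (meson bij_betw_def inj_onD)
    have \<rho>inj: "v = w" if "v \<in> verts B" "w \<in> verts B" "\<rho> v = \<rho> w" for v w
      using that \<rho>(1) by (meson bij_betw_def inj_onD)
    from xy(1) show "x = y"
    proof
      assume "x \<in> ?a ` verts A"
      then obtain v where v: "v \<in> verts A" "x = ?a v" by blast
      from xy(2) show ?thesis
      proof
        assume "y \<in> ?a ` verts A"
        then show ?thesis using v xy(3) \<tau>a \<pi>inj by (metis imageE)
      next
        assume "y \<in> ?b ` verts B"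
        then obtain w where "w \<in> verts B" "y = ?b w" by blast
        then show ?thesis using v xy(3) \<tau>a \<tau>b cross by metis
      qed
    next
      assume "x \<in> ?b ` verts B"
      then obtain v where v: "v \<in> verts B" "x = ?b v" by blast
      from xy(2) show ?thesis
      proof
        assume "y \<in> ?a ` verts A"
        then obtain w where "w \<in> verts A" "y = ?a w" by blast
        then show ?thesis using v xy(3) \<tau>a \<tau>b cross by metis
      next
        assume "y \<in> ?b ` verts B"
        then show ?thesis using v xy(3) \<tau>b \<rho>inj by (metis imageE)
      qed
    qed
  qed
  have img: "\<tau> ` (?a ` verts A \<union> ?b ` verts B) = verts G \<union> verts H"
  proof -
    have "\<tau> ` ?a ` verts A = \<pi> ` verts A" unfolding image_image using \<tau>a by (intro image_cong) auto
    moreover have "\<tau> ` ?b ` verts B = \<rho> ` verts B" unfolding image_image using \<tau>b by (intro image_cong) auto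
    ultimately show ?thesis using \<pi>(1) \<rho>(1) by (simp add: image_Un bij_betw_def)
  qed
  have "\<tau> ` ?a ` e = \<pi> ` e" if "e \<in># edges A" for e
    unfolding image_image using that \<tau>a A'(1) by (intro image_cong) (auto simp: is_graph_def)
  moreover have "\<tau> ` ?b ` e = \<rho> ` e" if "e \<in># edges B" for e
    unfolding image_image using that \<tau>b B'(1) by (intro image_cong) (auto simp: is_graph_def)
  ultimately have ed: "image_mset (\<lambda>e. \<tau> ` e) (edges (lprod A B)) = edges G + edges H"
    unfolding \<pi>(2) \<rho>(2) lprod_sel image_mset_union multiset.map_comp comp_def
    by (intro arg_cong2[where f = "(+)"] image_mset_cong) auto
  have "map \<tau> [0..<k] = ?ls"
  proof (rule nth_equalityI)
    fix i assume "i < length (map \<tau> [0..<k])"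
    then have i: "i < k" by simp
    then have "\<tau> i = \<tau> (?a (labels A ! i))" using glue_name_nth A' by metis
    also have "\<dots> = ?ls ! i" using i A' \<tau>a \<pi>i by (metis nth_mem subsetD)
    finally show "map \<tau> [0..<k] ! i = ?ls ! i" using i by simp
  qed (use lk in simp)
  then show ?thesis
    unfolding labeled_iso_def graph_iso_def
    using inj img ed A'(2) by (intro exI[of _ \<tau>]) (simp add: bij_betw_def)
qed

text \<open>Passes from arbitrary labeled graphs to the encoding by sets; the parameter
  \<open>T\<close> allows representatives of several factors to be kept apart.\<close>

lemma PLG_representative:
  assumes A: "A \<in> PLG k" and S: "finite S" "card S = k" and T: "finite T"
  obtains G where "sgraph S G" "verts G \<inter> T \<subseteq> S" "labeled_iso A (lab S G)"
proof -
  note A' = PLG_D[OF A]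
  let ?ls = "sorted_list_of_set S" and ?g = "glue_name (labels A) 0"
  \<comment> \<open>After \<open>glue_name\<close> the labels are the numbers below
    \<open>k\<close>; these go to \<open>S\<close> in order, all other names beyond
    \<open>S \<union> T\<close>.\<close>
  define h where "h m = (if m < k then ?ls ! m else m + Suc (Max (insert 0 (S \<union> T))))" for m
  have lsS: "?ls ! m \<in> S" if "m < k" for m
    using that S by (metis length_sorted_list_of_set nth_mem set_sorted_list_of_set)
  have h_avoids: "h m \<notin> S \<union> T" if "\<not> m < k" for m
  proof
    assume "h m \<in> S \<union> T"
    then have "h m \<le> Max (insert 0 (S \<union> T))" using S T by (intro Max_ge) auto
    then show False using that by (simp add: h_def)
  qed
  have "inj h"
  proof (rule injI)
    fix m n assume eq: "h m = h n"
    have "m < k \<longleftrightarrow> n < k" using eq lsS h_avoids unfolding h_def by (metis UnI1)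
    then show "m = n" using eq S nth_eq_iff_index_eq[of ?ls m n] by (auto simp: h_def split: if_splits)
  qed
  then have inj: "inj (h \<circ> ?g)" using inj_glue_name[OF A'(3)] by (intro inj_compose)
  define G where "G = \<lparr>verts = (h \<circ> ?g) ` verts A, edges = image_mset (\<lambda>e. (h \<circ> ?g) ` e) (edges A)\<rparr>"
  have labels: "map (h \<circ> ?g) (labels A) = ?ls"
  proof (rule nth_equalityI)
    fix i assume "i < length (map (h \<circ> ?g) (labels A))"
    then show "map (h \<circ> ?g) (labels A) ! i = ?ls ! i"
      using A' by (simp add: glue_name_nth h_def)
  qed (use A' S in simp)
  have "S = (h \<circ> ?g) ` set (labels A)" using arg_cong[OF labels, of set] S by simp
  then have SG: "S \<subseteq> verts G" using A'(4) by (auto simp: G_def)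
  have "card ((h \<circ> ?g) ` e) = card e" for e by (rule card_image[OF inj_on_subset[OF inj]]) simp
  then have "is_graph G" using A'(1,5) by (auto simp: is_graph_def G_def simp del: o_apply)
  then have "sgraph S G" using SG by (simp add: sgraph_def)
  moreover have "verts G \<inter> T \<subseteq> S"
  proof
    fix y assume y: "y \<in> verts G \<inter> T"
    then obtain v where "y = h (?g v)" by (auto simp: G_def)
    then show "y \<in> S" using y h_avoids lsS by (cases "?g v < k") (auto simp: h_def)
  qed
  moreover have "labeled_iso A (lab S G)"
    unfolding labeled_iso_def graph_iso_def
    using labels inj_on_subset[OF inj]
    by (intro exI[of _ "h \<circ> ?g"]) (simp add: bij_betw_def G_def del: o_apply map_map)
  ultimately show ?thesis using that by blast
qed

section \<open>From the connection tensor to a sum of characters\<close>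

lemma graph_parameter_labeled_iso:
  assumes f: "graph_parameter f" and A: "A \<in> PLG k" and G: "is_graph G" and iso: "labeled_iso A (lab S G)"
  shows "f (mgraph.truncate A) = f G"
proof -
  have "is_graph (mgraph.truncate A)" using PLG_D(1)[OF A] by (simp add: is_graph_def)
  moreover have "\<exists>\<pi>. graph_iso \<pi> (mgraph.truncate A) G" using iso by (auto simp: labeled_iso_def graph_iso_def)
  ultimately show ?thesis using f G unfolding graph_parameter_def by blast
qed

lemma graph_parameter_gmap:
  assumes f: "graph_parameter f" and G: "is_graph G" and \<pi>: "inj_on \<pi> (verts G)"
  shows "f (gmap \<pi> G) = f G"
proof -
  have "graph_iso \<pi> G (gmap \<pi> G)" using \<pi> by (auto simp: graph_iso_def bij_betw_def)
  then show ?thesis using f G is_graph_gmap[OF G \<pi>] unfolding graph_parameter_def by metis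
qed

lemma foldr_lprod_PLG: "set As \<subseteq> PLG k \<Longrightarrow> foldr lprod As (U_graph k) \<in> PLG k"
  by (induction As) (auto intro: lprod_PLG U_graph_PLG)

text \<open>\<open>lprod\<close> is associative and unital only up to isomorphism. With
  representatives that meet in \<open>S\<close>, both folds are isomorphic to the same union, and
  \<open>f\<close> is invariant.\<close>

lemma conn_tensor_assoc:
  assumes f: "graph_parameter f" and A: "A \<in> PLG k" and B: "B \<in> PLG k" and As: "set As \<subseteq> PLG k"
  shows "conn_tensor f k (A # B # As) = conn_tensor f k (lprod A B # U_graph k # As)"
proof -
  define S where "S = {..<k}"
  have S: "finite S" "card S = k" by (simp_all add: S_def)
  define R where "R = foldr lprod As (U_graph k)"
  have R: "R \<in> PLG k" unfolding R_def using As by (rule foldr_lprod_PLG)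
  note U = U_graph_PLG[of k]
  obtain G where G: "sgraph S G" "labeled_iso A (lab S G)"
    using PLG_representative[OF A S, of "{}"] by auto
  obtain H where H: "sgraph S H" "verts H \<inter> verts G \<subseteq> S" "labeled_iso B (lab S H)"
    using PLG_representative[OF B S sgraph_finite(1)[OF G(1)]] by auto
  have fin: "finite (verts G \<union> verts H)" using sgraph_finite(1) G H by blast
  obtain K where K: "sgraph S K" "verts K \<inter> (verts G \<union> verts H) \<subseteq> S" "labeled_iso R (lab S K)"
    using PLG_representative[OF R S fin] by auto
  have sub: "S \<subseteq> verts G" "S \<subseteq> verts H" "S \<subseteq> verts K" using G H K by (auto simp: sgraph_def)
  have "labeled_iso (lprod A (lprod B R)) (lab S (gunion G (gunion H K)))"
    using G H K sub by (intro labeled_iso_lprod[where k = k] S(1) lprod_PLG A B R) auto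
  moreover have "labeled_iso (lprod (lprod A B) (lprod (U_graph k) R)) (lab S (gunion (gunion G H) (gunion (edgeless S) K)))"
    using G H K sub
    by (intro labeled_iso_lprod[where k = k] labeled_iso_U_graph S lprod_PLG A B R U) auto
  moreover have "gunion (gunion G H) (gunion (edgeless S) K) = gunion G (gunion H K)"
    using sub by (simp add: gunion_edgeless_left gunion_assoc)
  moreover have "is_graph (gunion G (gunion H K))" using G H K by (auto simp: sgraph_def)
  ultimately have "f (mgraph.truncate (lprod A (lprod B R))) = f (mgraph.truncate (lprod (lprod A B) (lprod (U_graph k) R)))"
    using graph_parameter_labeled_iso[OF f] lprod_PLG A B R U by metis
  then show ?thesis by (simp add: conn_tensor_def R_def)
qed

lemma conn_tensor_unit:
  assumes f: "graph_parameter f" and S: "card S = k" and G: "sgraph S G"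
  shows "conn_tensor f k (lab S G # replicate n (U_graph k)) = f G"
proof -
  note S = sgraph_finite(2)[OF G] S and U = U_graph_PLG[of k]
  have UP: "foldr lprod (replicate n (U_graph k)) (U_graph k) \<in> PLG k" for n
    using U by (intro foldr_lprod_PLG) auto
  have "labeled_iso (foldr lprod (replicate n (U_graph k)) (U_graph k)) (lab S (edgeless S))" for n
  proof (induction n)
    case (Suc n)
    have "labeled_iso (foldr lprod (replicate (Suc n) (U_graph k)) (U_graph k)) (lab S (gunion (edgeless S) (edgeless S)))"
      using labeled_iso_lprod[OF S(1) U UP labeled_iso_U_graph[OF S] Suc.IH] by simp
    then show ?case by (simp add: gunion_edgeless)
  qed (simp add: labeled_iso_U_graph[OF S])
  moreover have "labeled_iso (lab S G) (lab S G)"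
    unfolding labeled_iso_def graph_iso_def by (intro exI[of _ id]) (auto simp: bij_betw_def)
  ultimately have "labeled_iso (lprod (lab S G) (foldr lprod (replicate n (U_graph k)) (U_graph k))) (lab S (gunion G (edgeless S)))"
    using G by (intro labeled_iso_lprod[OF S(1) lab_PLG[OF G S(2)] UP]) (auto simp: sgraph_def)
  moreover have "gunion G (edgeless S) = G" using G by (intro gunion_edgeless) (auto simp: sgraph_def)
  ultimately show ?thesis
    using graph_parameter_labeled_iso[OF f lprod_PLG[OF lab_PLG[OF G S(2)] UP]] G
    by (simp add: conn_tensor_def sgraph_def)
qed

text \<open>In \<open>enat\<close> a nonempty set attains its infimum, and a finite bound excludes
  the empty set.\<close>

lemma sym_rank_le_iff: "sym_rank k n T \<le> enat N \<longleftrightarrow> (\<exists>r\<le>N. sym_decomp k n T r)"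
proof
  assume le: "sym_rank k n T \<le> enat N"
  let ?A = "{enat r |r. sym_decomp k n T r}"
  have "?A \<noteq> {}"
  proof
    assume "?A = {}"
    then show False using le unfolding sym_rank_def by (simp only: Inf_empty) (simp add: top_enat_def)
  qed
  then have "sym_rank k n T \<in> ?A"
    unfolding sym_rank_def Inf_enat_def by (metis (mono_tags, lifting) LeastI ex_in_conv)
  then show "\<exists>r\<le>N. sym_decomp k n T r" using le by auto
next
  assume "\<exists>r\<le>N. sym_decomp k n T r"
  then obtain r where r: "r \<le> N" "sym_decomp k n T r" by blast
  have "sym_rank k n T \<le> enat r" unfolding sym_rank_def using r by (intro Inf_lower) auto
  also have "\<dots> \<le> enat N" using r by simp
  finally show "sym_rank k n T \<le> enat N" .
qed

lemma graph_parameter_character_sum: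
  fixes f :: "mgraph \<Rightarrow> 'a::field"
  assumes f: "graph_parameter f" and rank: "\<And>n. sym_rank k n (conn_tensor f k) \<le> enat N"
    and S: "finite S" "card S = k"
  obtains X l where "finite X" "card X \<le> N" "\<And>\<chi>. \<chi> \<in> X \<Longrightarrow> character S \<chi>" "\<And>\<chi>. \<chi> \<in> X \<Longrightarrow> l \<chi> \<noteq> 0"
    "\<And>G. sgraph S G \<Longrightarrow> f G = (\<Sum>\<chi>\<in>X. l \<chi> * \<chi> G)"
proof -
  \<comment> \<open>Two more than \<open>N\<close>, so that \<open>r \<le> N\<close> terms remain
    independent after two slots are spent.\<close>
  let ?n = "Suc (Suc N)"
  obtain r where r: "r \<le> N" "sym_decomp k ?n (conn_tensor f k) r" using rank sym_rank_le_iff by blast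
  then obtain c and x :: "nat \<Rightarrow> lgraph \<Rightarrow> 'a" where x: "\<And>i. i < r \<Longrightarrow> x i \<in> PLG_functions k"
    and dec: "\<And>As. length As = ?n \<Longrightarrow> set As \<subseteq> PLG k \<Longrightarrow> conn_tensor f k As = (\<Sum>i<r. c i * prod_list (map (x i) As))"
    unfolding sym_decomp_def tensor_power_def by blast
  let ?U = "U_graph k"
  obtain I l where I: "I \<subseteq> {..<r}" and l: "\<And>i. i \<in> I \<Longrightarrow> l i \<noteq> 0" and e: "\<And>i. i \<in> I \<Longrightarrow> x i ?U \<noteq> 0"
    and mult: "\<And>i A B. i \<in> I \<Longrightarrow> A \<in> PLG k \<Longrightarrow> B \<in> PLG k \<Longrightarrow> x i (lprod A B) * x i ?U = x i A * x i B"
    and dist: "\<And>i j. i \<in> I \<Longrightarrow> j \<in> I \<Longrightarrow> i \<noteq> j \<Longrightarrow> \<exists>A\<in>PLG k. x i A / x i ?U \<noteq> x j A / x j ?U"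
    and sum: "\<And>A. A \<in> PLG k \<Longrightarrow> conn_tensor f k (A # replicate (Suc N) ?U) = (\<Sum>i\<in>I. l i * (x i A / x i ?U))"
    by (rule decomposition_characters[OF r(1) dec U_graph_PLG lprod_PLG conn_tensor_assoc[OF f]]) auto
  have iso: "x i A = x i B" if "i \<in> I" "A \<in> PLG k" "B \<in> PLG k" "labeled_iso A B" for i A B
    using x[of i] that I unfolding PLG_functions_def by blast
  define y where "y i G = (if sgraph S G then x i (lab S G) / x i ?U else 0)" for i G
  note lP = lab_PLG[OF _ S(2)]
  have refl: "labeled_iso (lab S G) (lab S G)" for G
    unfolding labeled_iso_def graph_iso_def by (intro exI[of _ id]) (auto simp: bij_betw_def)
  have char: "character S (y i)" if i: "i \<in> I" for i
    unfolding character_def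
  proof (intro conjI allI impI)
    show "y i (edgeless S) = 1"
      using iso[OF i U_graph_PLG lP[OF sgraph_edgeless] labeled_iso_U_graph[OF S]] e[OF i] S
      by (simp add: y_def sgraph_edgeless)
  next
    fix G \<pi> assume G: "sgraph S G" "inj_on \<pi> (verts G)" "\<forall>v\<in>S. \<pi> v = v"
    have "labeled_iso (lab S G) (lab S (gmap \<pi> G))"
      unfolding labeled_iso_def graph_iso_def using G S
      by (intro exI[of _ \<pi>]) (auto simp: bij_betw_def intro!: map_idI)
    then show "y i (gmap \<pi> G) = y i G"
      using iso[OF i lP[OF G(1)] lP[OF sgraph_gmap[OF G]]] G(1) sgraph_gmap[OF G] by (simp add: y_def)
  next
    fix G H assume G: "sgraph S G" and H: "sgraph S H" and GH: "verts G \<inter> verts H = S"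
    have s: "sgraph S (gunion G H)" using sgraph_gunion[OF G] H by (simp add: sgraph_def)
    have "x i (lab S (gunion G H)) = x i (lprod (lab S G) (lab S H))"
      using iso[OF i lprod_PLG[OF lP[OF G] lP[OF H]] lP[OF s]]
        labeled_iso_lprod[OF S(1) lP[OF G] lP[OF H] refl refl GH] by simp
    also have "\<dots> = x i (lab S G) * x i (lab S H) / x i ?U"
      using mult[OF i lP[OF G] lP[OF H]] e[OF i] by (simp add: field_simps)
    finally show "y i (gunion G H) = y i G * y i H" using G H s by (simp add: y_def)
  qed (simp add: y_def)
  \<comment> \<open>Distinct indices must give distinct characters for the sum over indices to
    become a sum over a set of characters.\<close>
  have inj: "inj_on y I"
  proof (rule inj_onI, rule ccontr)
    fix i j assume ij: "i \<in> I" "j \<in> I" "y i = y j" "i \<noteq> j"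
    obtain A where A: "A \<in> PLG k" "x i A / x i ?U \<noteq> x j A / x j ?U" using dist ij by blast
    obtain G where G: "sgraph S G" "labeled_iso A (lab S G)" using PLG_representative[OF A(1) S, of "{}"] by auto
    have "y i G \<noteq> y j G"
      using iso[OF ij(1) A(1) lP[OF G(1)] G(2)] iso[OF ij(2) A(1) lP[OF G(1)] G(2)] A(2) G(1)
      by (simp add: y_def)
    then show False using ij by simp
  qed
  show ?thesis
  proof (rule that[of "y ` I" "\<lambda>\<chi>. l (inv_into I y \<chi>)"])
    show "finite (y ` I)" using I finite_subset by blast
    have "card (y ` I) \<le> card I" using I finite_subset card_image_le by blast
    also have "\<dots> \<le> N" using card_mono[OF _ I] r(1) by simp
    finally show "card (y ` I) \<le> N" .
    show "character S \<chi>" if "\<chi> \<in> y ` I" for \<chi> using that char by auto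
    show "l (inv_into I y \<chi>) \<noteq> 0" if "\<chi> \<in> y ` I" for \<chi> using that l inj by auto
    show "f G = (\<Sum>\<chi>\<in>y ` I. l (inv_into I y \<chi>) * \<chi> G)" if G: "sgraph S G" for G
      using conn_tensor_unit[OF f S(2) G, of "Suc N"] sum[OF lP[OF G]] inj G
      by (simp add: sum.reindex y_def)
  qed
qed

section \<open>Restriction and amalgamation\<close>

text \<open>Independence on \<open>Y \<union> Z\<close>, applied to the difference. The conditional
  form also settles membership: a nonzero coefficient on one side forces the character to occur on
  the other.\<close>

lemma character_combinations_eq:
  assumes "finite Y" "finite Z" "finite T" "finite S"
    and char: "\<And>\<chi>. \<chi> \<in> Y \<union> Z \<Longrightarrow> character S \<chi>"
    and eq: "\<And>G. sgraph S G \<Longrightarrow> verts G \<inter> T \<subseteq> S \<Longrightarrow> (\<Sum>\<chi>\<in>Y. c \<chi> * \<chi> G) = (\<Sum>\<chi>\<in>Z. d \<chi> * \<chi> G)"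
  shows "(if \<chi> \<in> Y then c \<chi> else 0) = (if \<chi> \<in> Z then d \<chi> else 0)"
proof (cases "\<chi> \<in> Y \<union> Z")
  case True
  have "(if \<chi> \<in> Y then c \<chi> else 0) - (if \<chi> \<in> Z then d \<chi> else 0) = 0"
  proof (rule characters_independent[where Y = "Y \<union> Z" and T = T and S = S
        and c = "\<lambda>\<chi>. (if \<chi> \<in> Y then c \<chi> else 0) - (if \<chi> \<in> Z then d \<chi> else 0)"])
    fix G assume G: "sgraph S G" "verts G \<inter> T \<subseteq> S"
    have "(\<Sum>\<chi>\<in>Y \<union> Z. ((if \<chi> \<in> Y then c \<chi> else 0) - (if \<chi> \<in> Z then d \<chi> else 0)) * \<chi> G)
        = (\<Sum>\<chi>\<in>Y \<union> Z. if \<chi> \<in> Y then c \<chi> * \<chi> G else 0) - (\<Sum>\<chi>\<in>Y \<union> Z. if \<chi> \<in> Z then d \<chi> * \<chi> G else 0)"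
      unfolding sum_subtractf[symmetric] by (intro sum.cong) (auto simp: algebra_simps)
    also have "\<dots> = (\<Sum>\<chi>\<in>Y. c \<chi> * \<chi> G) - (\<Sum>\<chi>\<in>Z. d \<chi> * \<chi> G)"
      using assms(1,2) by (intro arg_cong2[where f = "(-)"] sum.mono_neutral_cong_right) auto
    finally show "(\<Sum>\<chi>\<in>Y \<union> Z. ((if \<chi> \<in> Y then c \<chi> else 0) - (if \<chi> \<in> Z then d \<chi> else 0)) * \<chi> G) = 0"
      using eq[OF G] by simp
  qed (use assms True in auto)
  then show ?thesis by simp
qed auto

lemma exponential_growth_bound:
  fixes d q s :: nat
  assumes "\<And>m. d ^ m \<le> q ^ (s + m)"
  shows "d \<le> q"
proof (rule ccontr)
  assume "\<not> d \<le> q"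
  then have d: "Suc q \<le> d" by simp
  show False
  proof (cases "q = 0")
    case True
    then show False using assms[of 1] d by simp
  next
    case False
    \<comment> \<open>Chosen so that the second Bernoulli term \<open>m * q ^ (m - 1)\<close> equals
      \<open>q ^ (s + m)\<close>.\<close>
    define m where "m = q ^ Suc s"
    have bernoulli: "q ^ k + k * q ^ (k - 1) \<le> Suc q ^ k" for k
    proof (induction k)
      case (Suc k)
      have "q ^ Suc k + Suc k * q ^ (Suc k - 1) \<le> Suc q * (q ^ k + k * q ^ (k - 1))"
        by (cases k) (simp_all add: algebra_simps)
      also have "\<dots> \<le> Suc q * Suc q ^ k" using Suc.IH by (rule mult_le_mono2)
      finally show ?case by simp
    qed simp
    have m: "m > 0" using False by (simp add: m_def)
    then have q: "q ^ m = q * q ^ (m - 1)" using power_Suc[of q "m - 1"] by simp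
    have "q ^ (s + m) = q ^ s * (q * q ^ (m - 1))" unfolding power_add q ..
    also have "\<dots> = m * q ^ (m - 1)" by (simp add: m_def)
    also have "\<dots> < q ^ m + m * q ^ (m - 1)" using False by simp
    also have "\<dots> \<le> Suc q ^ m" by (rule bernoulli)
    also have "\<dots> \<le> d ^ m" using d by (rule power_mono) simp
    finally show False using assms[of m] by simp
  qed
qed

section \<open>Compatibility of the expansions for different label sets\<close>

text \<open>No relation between expansions for different \<open>S\<close> is assumed; every such
  relation is derived by comparing coefficients.\<close>

locale char_system =
  fixes f :: "mgraph \<Rightarrow> 'a::field" and X :: "nat set \<Rightarrow> (mgraph \<Rightarrow> 'a) set"
    and lam :: "nat set \<Rightarrow> (mgraph \<Rightarrow> 'a) \<Rightarrow> 'a" and q :: nat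
  assumes f_gmap: "is_graph G \<Longrightarrow> inj_on \<pi> (verts G) \<Longrightarrow> f (gmap \<pi> G) = f G"
    and f_K0: "f K0 = 1"
    and finite_X: "finite S \<Longrightarrow> finite (X S)"
    and card_X: "finite S \<Longrightarrow> card (X S) \<le> q ^ card S"
    and character_X: "finite S \<Longrightarrow> \<chi> \<in> X S \<Longrightarrow> character S \<chi>"
    and lam_nonzero: "finite S \<Longrightarrow> \<chi> \<in> X S \<Longrightarrow> lam S \<chi> \<noteq> 0"
    and expansion: "sgraph S G \<Longrightarrow> f G = (\<Sum>\<chi>\<in>X S. lam S \<chi> * \<chi> G)"
begin

definition fiber :: "nat set \<Rightarrow> nat set \<Rightarrow> (mgraph \<Rightarrow> 'a) \<Rightarrow> (mgraph \<Rightarrow> 'a) set" where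
  "fiber S T \<psi> = {\<chi> \<in> X T. restr S T \<chi> = \<psi>}"

lemma finite_fiber: "finite T \<Longrightarrow> finite (fiber S T \<psi>)"
  by (simp add: fiber_def finite_X)

text \<open>Glue a variable \<open>S\<close>-labeled graph \<open>G\<close> to the fixed
  \<open>H\<close> and expand \<open>f\<close> of the union over \<open>S\<close> and over
  \<open>T\<close>; the coefficients of the \<open>S\<close>-characters of \<open>G\<close> must
  agree.\<close>

lemma restr_expansion:
  assumes T: "S \<subseteq> T" "finite T" and H: "sgraph T H"
  shows "(if \<psi> \<in> X S then lam S \<psi> * \<psi> H else 0) = (\<Sum>\<chi>\<in>fiber S T \<psi>. lam T \<chi> * \<chi> H)"
proof -
  have S: "finite S" using T finite_subset by blast
  let ?d = "\<lambda>\<psi>. \<Sum>\<chi>\<in>fiber S T \<psi>. lam T \<chi> * \<chi> H"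
  have "(if \<psi> \<in> X S then lam S \<psi> * \<psi> H else 0) = (if \<psi> \<in> restr S T ` X T then ?d \<psi> else 0)"
  proof (rule character_combinations_eq[where T = "verts H" and S = S])
    fix G assume G: "sgraph S G" "verts G \<inter> verts H \<subseteq> S"
    have "S \<subseteq> verts G" "T \<subseteq> verts H" using G H by (auto simp: sgraph_def)
    then have GH: "verts G \<inter> verts H = S" and GT: "verts G \<inter> T \<subseteq> S"
      and GTH: "verts (gunion G (edgeless T)) \<inter> verts H = T" using G T by auto
    have s: "sgraph S (gunion G H)" using sgraph_gunion[OF G(1)] H by (simp add: sgraph_def)
    have t: "sgraph T (gunion G H)" using \<open>T \<subseteq> verts H\<close> s by (auto simp: sgraph_def)
    have GT': "sgraph T (gunion G (edgeless T))" using G T by (auto simp: sgraph_def)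
    have eq: "gunion (gunion G (edgeless T)) H = gunion G H"
      using \<open>T \<subseteq> verts H\<close> by (auto intro!: mgraph_eqI)
    have "(\<Sum>\<psi>\<in>X S. lam S \<psi> * \<psi> H * \<psi> G) = (\<Sum>\<psi>\<in>X S. lam S \<psi> * \<psi> (gunion G H))"
      by (intro sum.cong) (simp_all add: character_mult[OF character_X[OF S] G(1) sgraph_mono[OF H T(1)] GH])
    also have "\<dots> = f (gunion G H)" by (rule expansion[OF s, symmetric])
    also have "\<dots> = (\<Sum>\<chi>\<in>X T. lam T \<chi> * \<chi> (gunion G H))" by (rule expansion[OF t])
    also have "\<dots> = (\<Sum>\<chi>\<in>X T. lam T \<chi> * \<chi> H * restr S T \<chi> G)"
    proof (rule sum.cong)
      fix \<chi> assume \<chi>: "\<chi> \<in> X T"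
      note c = character_X[OF T(2) \<chi>]
      have "\<chi> (gunion G H) = \<chi> (gunion G (edgeless T)) * \<chi> H"
        using character_mult[OF c GT' H GTH] eq by simp
      then show "lam T \<chi> * \<chi> (gunion G H) = lam T \<chi> * \<chi> H * restr S T \<chi> G"
        by (simp add: restr_eq[OF c G(1) T GT])
    qed simp
    also have "\<dots> = (\<Sum>\<psi>\<in>restr S T ` X T. \<Sum>\<chi>\<in>fiber S T \<psi>. lam T \<chi> * \<chi> H * restr S T \<chi> G)"
      unfolding fiber_def by (rule sum.image_gen[OF finite_X[OF T(2)]])
    also have "\<dots> = (\<Sum>\<psi>\<in>restr S T ` X T. ?d \<psi> * \<psi> G)"
      unfolding sum_distrib_right by (intro sum.cong) (auto simp: fiber_def)
    finally show "(\<Sum>\<psi>\<in>X S. lam S \<psi> * \<psi> H * \<psi> G) = (\<Sum>\<psi>\<in>restr S T ` X T. ?d \<psi> * \<psi> G)" .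
  next
    fix \<chi> assume "\<chi> \<in> X S \<union> restr S T ` X T"
    then show "character S \<chi>" using character_X S T character_restr by blast
  qed (use S T finite_X sgraph_finite[OF H] in auto)
  also have "\<dots> = ?d \<psi>"
  proof (cases "\<psi> \<in> restr S T ` X T")
    case False
    then have "fiber S T \<psi> = {}" by (auto simp: fiber_def)
    then show ?thesis using False by (simp only: sum.empty if_False)
  qed simp
  finally show ?thesis .
qed

text \<open>Otherwise the weighted sum over the fiber would vanish identically, against independence
  and nonzero coefficients.\<close>

lemma restr_X:
  assumes T: "S \<subseteq> T" "finite T" and \<chi>: "\<chi> \<in> X T"
  shows "restr S T \<chi> \<in> X S"
proof (rule ccontr)
  assume "restr S T \<chi> \<notin> X S"
  then have zero: "(\<Sum>\<chi>'\<in>fiber S T (restr S T \<chi>). lam T \<chi>' * \<chi>' H) = 0" if "sgraph T H" for H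
    using restr_expansion[OF T that, of "restr S T \<chi>"] by simp
  have "lam T \<chi> = 0"
  proof (rule characters_independent[where Y = "fiber S T (restr S T \<chi>)" and T = "{}" and S = T and c = "lam T"])
    show "finite (fiber S T (restr S T \<chi>))" using T(2) by (rule finite_fiber)
    show "character T \<xi>" if "\<xi> \<in> fiber S T (restr S T \<chi>)" for \<xi>
      using that character_X[OF T(2)] by (simp add: fiber_def)
    show "\<chi> \<in> fiber S T (restr S T \<chi>)" using \<chi> by (simp add: fiber_def)
  qed (use zero T in auto)
  then show False using lam_nonzero T \<chi> by blast
qed

lemma fiber_restr:
  assumes "S \<subseteq> T" "T \<subseteq> U" "finite U" "\<chi> \<in> fiber S U \<psi>"
  shows "restr T U \<chi> \<in> fiber S T \<psi>"
proof -
  have \<chi>: "\<chi> \<in> X U" "restr S U \<chi> = \<psi>" using assms(4) by (simp_all add: fiber_def)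
  then show ?thesis
    using restr_X[OF assms(2,3) \<chi>(1)] restr_restr[OF character_X[OF assms(3) \<chi>(1)] assms(1,2,3)]
    by (simp add: fiber_def)
qed

lemma fiber_self: "finite S \<Longrightarrow> \<psi> \<in> X S \<Longrightarrow> fiber S S \<psi> = {\<psi>}"
  using restr_self[OF character_X] by (auto simp: fiber_def)

text \<open>For a \<open>T2\<close>-labeled \<open>H\<close> that meets \<open>T1\<close> inside
  \<open>S\<close>, the value \<open>\<psi> H\<close> is expanded twice: over the extensions of
  \<psi> to \<open>T2\<close>, and as \<chi>1 at \<open>H\<close> with \<open>T1\<close> added, over
  the extensions of \<chi>1 to \<open>T1 \<union> T2\<close>. Comparing coefficients of
  \<open>T2\<close>-characters gives the identity.\<close>

lemma amalgamation:
  assumes T: "finite T1" "finite T2" "T1 \<inter> T2 = S"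
    and \<chi>1: "\<chi>1 \<in> fiber S T1 \<psi>" and \<chi>2: "\<chi>2 \<in> fiber S T2 \<psi>"
  shows "lam S \<psi> * (\<Sum>\<chi>\<in>{\<chi> \<in> fiber T1 (T1 \<union> T2) \<chi>1. restr T2 (T1 \<union> T2) \<chi> = \<chi>2}. lam (T1 \<union> T2) \<chi>)
    = lam T1 \<chi>1 * lam T2 \<chi>2"
proof -
  let ?T = "T1 \<union> T2"
  let ?F = "fiber T1 ?T \<chi>1"
  have S: "S \<subseteq> T1" "S \<subseteq> T2" "T1 \<subseteq> ?T" "T2 \<subseteq> ?T" "finite ?T" "finite S" using T by auto
  have X1: "\<chi>1 \<in> X T1" and \<psi>: "restr S T1 \<chi>1 = \<psi>" using \<chi>1 by (auto simp: fiber_def)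
  have X\<psi>: "\<psi> \<in> X S" using restr_X[OF S(1) T(1) X1] \<psi> by simp
  let ?d = "\<lambda>\<chi>2. lam S \<psi> * (\<Sum>\<chi>\<in>{\<chi> \<in> ?F. restr T2 ?T \<chi> = \<chi>2}. lam ?T \<chi>)"
  have "(if \<chi>2 \<in> fiber S T2 \<psi> then lam T1 \<chi>1 * lam T2 \<chi>2 else 0) = (if \<chi>2 \<in> restr T2 ?T ` ?F then ?d \<chi>2 else 0)"
  proof (rule character_combinations_eq[where T = ?T and S = T2])
    fix H assume H: "sgraph T2 H" "verts H \<inter> ?T \<subseteq> T2"
    have HT1: "sgraph ?T (gunion H (edgeless T1))" using H T by (auto simp: sgraph_def)
    have HS: "sgraph S H" using sgraph_mono[OF H(1) S(2)] .
    have "verts H \<inter> T1 \<subseteq> S" using H(2) T(3) by blast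
    then have "\<chi>1 (gunion H (edgeless T1)) = \<psi> H"
      using restr_eq[OF character_X[OF T(1) X1] HS S(1) T(1)] \<psi> by simp
    then have *: "lam T1 \<chi>1 * \<psi> H = (\<Sum>\<chi>\<in>?F. lam ?T \<chi> * \<chi> (gunion H (edgeless T1)))"
      using restr_expansion[OF S(3,5) HT1, of \<chi>1] X1 by simp
    have "(\<Sum>\<chi>2\<in>fiber S T2 \<psi>. lam T1 \<chi>1 * lam T2 \<chi>2 * \<chi>2 H) = lam T1 \<chi>1 * (\<Sum>\<chi>2\<in>fiber S T2 \<psi>. lam T2 \<chi>2 * \<chi>2 H)"
      by (simp add: sum_distrib_left mult.assoc)
    also have "\<dots> = lam S \<psi> * (lam T1 \<chi>1 * \<psi> H)"
      using restr_expansion[OF S(2) T(2) H(1), of \<psi>] X\<psi> by simp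
    also have "\<dots> = (\<Sum>\<chi>\<in>?F. lam S \<psi> * lam ?T \<chi> * restr T2 ?T \<chi> H)"
      unfolding * sum_distrib_left
    proof (rule sum.cong)
      fix \<chi> assume "\<chi> \<in> ?F"
      then have \<chi>: "character ?T \<chi>" using character_X[OF S(5)] by (auto simp: fiber_def)
      have "gunion H (edgeless T1) = gunion H (edgeless ?T)"
        using H(1) by (auto simp: sgraph_def intro!: mgraph_eqI)
      then show "lam S \<psi> * (lam ?T \<chi> * \<chi> (gunion H (edgeless T1))) = lam S \<psi> * lam ?T \<chi> * restr T2 ?T \<chi> H"
        by (simp add: restr_eq[OF \<chi> H(1) S(4,5) H(2)])
    qed simp
    also have "\<dots> = (\<Sum>\<chi>2\<in>restr T2 ?T ` ?F. \<Sum>\<chi>\<in>{\<chi> \<in> ?F. restr T2 ?T \<chi> = \<chi>2}. lam S \<psi> * lam ?T \<chi> * restr T2 ?T \<chi> H)"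
      by (rule sum.image_gen[OF finite_fiber[OF S(5)]])
    also have "\<dots> = (\<Sum>\<chi>2\<in>restr T2 ?T ` ?F. ?d \<chi>2 * \<chi>2 H)"
      unfolding sum_distrib_right sum_distrib_left by (intro sum.cong) auto
    finally show "(\<Sum>\<chi>2\<in>fiber S T2 \<psi>. lam T1 \<chi>1 * lam T2 \<chi>2 * \<chi>2 H) = (\<Sum>\<chi>2\<in>restr T2 ?T ` ?F. ?d \<chi>2 * \<chi>2 H)" .
  next
    fix \<chi> assume "\<chi> \<in> fiber S T2 \<psi> \<union> restr T2 ?T ` ?F"
    then show "character T2 \<chi>"
      using character_X[OF T(2)] restr_X[OF S(4,5)] by (auto simp: fiber_def)
  qed (use S T finite_fiber in auto)
  also have "\<dots> = ?d \<chi>2"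
  proof (cases "\<chi>2 \<in> restr T2 ?T ` ?F")
    case False
    then have "{\<chi> \<in> ?F. restr T2 ?T \<chi> = \<chi>2} = {}" by auto
    then show ?thesis using False by (simp only: sum.empty if_False mult_zero_right)
  qed simp
  finally show ?thesis using \<chi>2 by simp
qed

lemma amalgamation_exists:
  assumes T: "finite T1" "finite T2" "T1 \<inter> T2 = S"
    and \<chi>: "\<chi>1 \<in> fiber S T1 \<psi>" "\<chi>2 \<in> fiber S T2 \<psi>"
  obtains \<chi> where "\<chi> \<in> fiber T1 (T1 \<union> T2) \<chi>1" "restr T2 (T1 \<union> T2) \<chi> = \<chi>2"
proof -
  have "lam T1 \<chi>1 * lam T2 \<chi>2 \<noteq> 0" 
    using lam_nonzero[OF T(1)] lam_nonzero[OF T(2)] \<chi> by (simp add: fiber_def)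
  then have "{\<chi> \<in> fiber T1 (T1 \<union> T2) \<chi>1. restr T2 (T1 \<union> T2) \<chi> = \<chi>2} \<noteq> {}"
    using amalgamation[OF assms] by (metis sum.empty mult_zero_right)
  then show ?thesis using that by blast
qed

text \<open>The bound \<open>q ^ 0 = 1\<close> leaves at most one character, and evaluation at
  \<open>K0\<close> shows that it exists and has coefficient \<open>1\<close>.\<close>

lemma X_empty: obtains \<chi> where "X {} = {\<chi>}" "\<And>G. is_graph G \<Longrightarrow> \<chi> G = f G"
proof -
  have K0: "K0 = edgeless {}" by (simp add: K0_def edgeless_def)
  have s: "sgraph {} K0" by (simp add: K0 sgraph_def)
  have "X {} \<noteq> {}" using expansion[OF s] f_K0 by force
  moreover have "card (X {}) \<le> 1" using card_X[of "{}"] by simp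
  ultimately obtain \<chi> where \<chi>: "X {} = {\<chi>}"
    using card_0_eq[OF finite_X[OF finite.emptyI]] by (metis card_1_singletonE le_antisym less_one not_le)
  have "lam {} \<chi> * \<chi> K0 = 1" using expansion[OF s] f_K0 \<chi> by simp
  then have "lam {} \<chi> = 1" using character_one[OF character_X[of "{}" \<chi>]] \<chi> K0 by simp
  then have "\<chi> G = f G" if "is_graph G" for G using expansion[of "{}" G] that \<chi> by (simp add: sgraph_def)
  then show ?thesis using that \<chi> by blast
qed

lemma pull_X:
  assumes \<sigma>: "bij \<sigma>" and S: "finite S" and \<chi>: "\<chi> \<in> X (\<sigma> ` S)"
  shows "pull \<sigma> \<chi> \<in> X S" "lam S (pull \<sigma> \<chi>) = lam (\<sigma> ` S) \<chi>"
proof -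
  have inv: "pull (inv \<sigma>) (pull \<sigma> \<chi>) = \<chi>" for \<chi> :: "mgraph \<Rightarrow> 'a"
    by (rule pull_inverse) (simp add: \<sigma> bij_is_surj surj_f_inv_f)
  have eq: "(if pull \<sigma> \<chi> \<in> X S then lam S (pull \<sigma> \<chi>) else 0)
      = (if pull \<sigma> \<chi> \<in> pull \<sigma> ` X (\<sigma> ` S) then lam (\<sigma> ` S) (pull (inv \<sigma>) (pull \<sigma> \<chi>)) else 0)"
  proof (rule character_combinations_eq[where T = "{}" and S = S])
    fix G assume G: "sgraph S G"
    have "inj_on \<sigma> (verts G)" using \<sigma> bij_is_inj inj_on_subset by blast
    then have "f G = f (gmap \<sigma> G)" using f_gmap G by (simp add: sgraph_def)
    also have "\<dots> = (\<Sum>\<chi>\<in>X (\<sigma> ` S). lam (\<sigma> ` S) \<chi> * \<chi> (gmap \<sigma> G))"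
      using sgraph_gmap_bij[OF \<sigma>] G by (intro expansion) simp
    also have "\<dots> = (\<Sum>\<chi>\<in>pull \<sigma> ` X (\<sigma> ` S). lam (\<sigma> ` S) (pull (inv \<sigma>) \<chi>) * \<chi> G)"
      unfolding sum.reindex[OF inj_on_subset[OF inj_pull[OF \<sigma>] subset_UNIV]] comp_def inv
      by (simp add: pull_def)
    finally show "(\<Sum>\<chi>\<in>X S. lam S \<chi> * \<chi> G) = (\<Sum>\<chi>\<in>pull \<sigma> ` X (\<sigma> ` S). lam (\<sigma> ` S) (pull (inv \<sigma>) \<chi>) * \<chi> G)"
      using expansion[OF G] by simp
  next
    show "character S \<chi>" if "\<chi> \<in> X S \<union> pull \<sigma> ` X (\<sigma> ` S)" for \<chi>
      using that character_X S character_pull[OF _ \<sigma>] by blast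
  qed (use S finite_X in auto)
  then have "(if pull \<sigma> \<chi> \<in> X S then lam S (pull \<sigma> \<chi>) else 0) = lam (\<sigma> ` S) \<chi>"
    using \<chi> inv by simp
  moreover have "lam (\<sigma> ` S) \<chi> \<noteq> 0" using lam_nonzero \<chi> S by blast
  ultimately show "pull \<sigma> \<chi> \<in> X S" "lam S (pull \<sigma> \<chi>) = lam (\<sigma> ` S) \<chi>" by (auto split: if_splits)
qed

lemma pull_fixing:
  assumes "finite S" "\<psi> \<in> X S" "bij \<sigma>" "\<And>v. v \<in> S \<Longrightarrow> \<sigma> v = v"
  shows "pull \<sigma> \<psi> = \<psi>"
proof -
  have "pull \<sigma> \<psi> = pull (\<lambda>v. v) \<psi>"
    using assms(4) by (intro pull_cong[OF character_X[OF assms(1,2)] assms(3), of _ S]) (simp_all add: bij_def)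
  also have "\<dots> = \<psi>" by (intro pull_inverse[of "\<lambda>v. v" "\<lambda>v. v", unfolded pull_pull, simplified comp_def]) simp
  finally show ?thesis .
qed

lemma pull_fiber:
  assumes T: "S \<subseteq> T" "finite T" and \<sigma>: "bij \<sigma>" "\<And>v. v \<in> S \<Longrightarrow> \<sigma> v = v"
    and \<chi>: "\<chi> \<in> fiber S (\<sigma> ` T) \<psi>"
  shows "pull \<sigma> \<chi> \<in> fiber S T \<psi>"
proof -
  have S: "\<sigma> ` S = S" "finite S" using \<sigma>(2) T finite_subset by (auto simp: image_def)
  have X: "\<chi> \<in> X (\<sigma> ` T)" "restr S (\<sigma> ` T) \<chi> = \<psi>" using \<chi> by (auto simp: fiber_def)
  have "S \<subseteq> \<sigma> ` T" using T(1) S(1) by blast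
  then have \<psi>: "\<psi> \<in> X S" using restr_X[OF _ _ X(1)] X(2) T by auto
  have "restr S T (pull \<sigma> \<chi>) = pull \<sigma> \<psi>"
    using restr_pull[OF character_X[OF _ X(1)] \<sigma>(1) T] S X(2) T by simp
  also have "\<dots> = \<psi>" by (rule pull_fixing[OF S(2) \<psi> \<sigma>])
  finally show ?thesis using pull_X(1)[OF \<sigma>(1) T(2) X(1)] by (simp add: fiber_def)
qed

lemma transpose_insert: "a \<notin> S \<Longrightarrow> b \<notin> S \<Longrightarrow> transpose a b ` insert b S = insert a S"
  by (auto simp: image_def transpose_def)

section \<open>The number of extensions by one label\<close>

text \<open>Swapping \<open>a\<close> and \<open>b\<close> fixes \<open>S\<close>, so it carries
  extensions at one label injectively to extensions at the other.\<close>

lemma card_fiber_insert_le: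
  assumes S: "finite S" and ab: "a \<notin> S" "b \<notin> S"
  shows "card (fiber S (insert a S) \<psi>) \<le> card (fiber S (insert b S) \<psi>)"
proof (rule card_inj_on_le)
  show "inj_on (pull (transpose a b)) (fiber S (insert a S) \<psi>)"
    using inj_on_subset[OF inj_pull[of "transpose a b"]] by simp
  have "transpose a b v = v" if "v \<in> S" for v using that ab by (auto simp: transpose_def)
  then have "pull (transpose a b) \<chi> \<in> fiber S (insert b S) \<psi>" if "\<chi> \<in> fiber S (insert a S) \<psi>" for \<chi>
    using that S transpose_insert[OF ab] by (intro pull_fiber) auto
  then show "pull (transpose a b) ` fiber S (insert a S) \<psi> \<subseteq> fiber S (insert b S) \<psi>" by blast
  show "finite (fiber S (insert b S) \<psi>)" using S by (simp add: finite_fiber)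
qed

lemma card_fiber_insert:
  assumes "finite S" "a \<notin> S" "b \<notin> S"
  shows "card (fiber S (insert a S) \<psi>) = card (fiber S (insert b S) \<psi>)"
  using card_fiber_insert_le assms by (meson le_antisym)

text \<open>By amalgamation, restricting to the old labels and to \<open>S\<close> with one new
  label covers all pairs of extensions, so each new label multiplies the count by at least the size
  of a one-label fiber.\<close>

lemma card_fiber_power:
  assumes S: "finite S" "\<psi> \<in> X S" "a \<notin> S" and W: "finite W" "W \<inter> S = {}"
  shows "card (fiber S (insert a S) \<psi>) ^ card W \<le> card (fiber S (S \<union> W) \<psi>)"
  using W
proof (induction W rule: finite_induct)
  case empty
  then show ?case using S by (simp add: fiber_self)
next
  case (insert b W)
  let ?T = "S \<union> W" and ?B = "insert b S"
  have fin: "finite ?T" "finite ?B" "finite (insert b ?T)" using S insert by auto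
  have meet: "?T \<inter> ?B = S" and join: "?T \<union> ?B = insert b ?T" using insert by auto
  have "fiber S ?T \<psi> \<times> fiber S ?B \<psi> \<subseteq> (\<lambda>\<chi>. (restr ?T (insert b ?T) \<chi>, restr ?B (insert b ?T) \<chi>)) ` fiber S (insert b ?T) \<psi>"
  proof
    fix p assume p: "p \<in> fiber S ?T \<psi> \<times> fiber S ?B \<psi>"
    obtain \<chi>1 \<chi>2 where pq: "p = (\<chi>1, \<chi>2)" "\<chi>1 \<in> fiber S ?T \<psi>" "\<chi>2 \<in> fiber S ?B \<psi>" using p by auto
    obtain \<chi> where \<chi>: "\<chi> \<in> fiber ?T (insert b ?T) \<chi>1" "restr ?B (insert b ?T) \<chi> = \<chi>2"
      using amalgamation_exists[OF fin(1,2) meet pq(2,3)] join by auto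
    have "character (insert b ?T) \<chi>" using \<chi>(1) character_X[OF fin(3)] by (simp add: fiber_def)
    then have "restr S (insert b ?T) \<chi> = restr S ?T (restr ?T (insert b ?T) \<chi>)"
      by (intro restr_restr[symmetric] fin) auto
    also have "\<dots> = \<psi>" using \<chi>(1) pq(2) by (simp add: fiber_def)
    finally have "restr S (insert b ?T) \<chi> = \<psi>" .
    then show "p \<in> (\<lambda>\<chi>. (restr ?T (insert b ?T) \<chi>, restr ?B (insert b ?T) \<chi>)) ` fiber S (insert b ?T) \<psi>"
      using \<chi> pq by (auto simp: fiber_def intro!: image_eqI[of _ _ \<chi>])
  qed
  then have "card (fiber S ?T \<psi> \<times> fiber S ?B \<psi>) \<le> card (fiber S (insert b ?T) \<psi>)"
    using finite_fiber[OF fin(3)] surj_card_le by blast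
  moreover have "card (fiber S ?B \<psi>) = card (fiber S (insert a S) \<psi>)"
    by (rule card_fiber_insert) (use S insert in auto)
  moreover have "card (fiber S (insert a S) \<psi>) ^ card W \<le> card (fiber S ?T \<psi>)"
    using insert.IH insert.prems by blast
  ultimately have "card (fiber S (insert a S) \<psi>) ^ card W * card (fiber S (insert a S) \<psi>) \<le> card (fiber S (insert b ?T) \<psi>)"
    by (metis card_cartesian_product le_trans mult_le_mono1)
  then show ?case using insert.hyps(1,2) by (metis Un_insert_right card_insert_disjoint power_Suc2)
qed

text \<open>The rank bound caps the extensions to \<open>m\<close> new labels at
  \<open>q ^ (card S + m)\<close>, while they number at least the \<open>m\<close>-th power of the
  one-label count.\<close>

lemma card_fiber_le:
  assumes S: "finite S" "\<psi> \<in> X S" "a \<notin> S"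
  shows "card (fiber S (insert a S) \<psi>) \<le> q"
proof (rule exponential_growth_bound[where s = "card S"])
  fix m
  have "infinite (- S)" using finite_compl[OF S(1)] by simp
  then obtain W where W: "finite W" "card W = m" "W \<subseteq> - S"
    using infinite_arbitrarily_large[of "- S" m] by blast
  then have WS: "W \<inter> S = {}" by blast
  have "card (fiber S (insert a S) \<psi>) ^ m \<le> card (fiber S (S \<union> W) \<psi>)"
    using card_fiber_power[OF S W(1) WS] W(2) by simp
  also have "\<dots> \<le> card (X (S \<union> W))"
    using S W by (intro card_mono finite_X) (auto simp: fiber_def)
  also have "\<dots> \<le> q ^ card (S \<union> W)" using S W by (intro card_X) auto
  also have "card (S \<union> W) = card S + m" using S W WS by (simp add: card_Un_disjoint Int_commute)
  finally show "card (fiber S (insert a S) \<psi>) ^ m \<le> q ^ (card S + m)" .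
qed

end

section \<open>The weighted graph of a maximal fiber\<close>

text \<open>When every node is labeled, the graph is the product of its single edges.\<close>

lemma character_edges:
  assumes \<chi>: "character T \<chi>" and T: "finite T" and "\<forall>e\<in>#M. e \<subseteq> T \<and> card e = 2"
  shows "\<chi> \<lparr>verts = T, edges = M\<rparr> = (\<Prod>e\<in>#M. \<chi> \<lparr>verts = T, edges = {#e#}\<rparr>)"
  using assms(3)
proof (induction M)
  case empty
  then show ?case using character_one[OF \<chi>] by (simp add: edgeless_def)
next
  case (add e M)
  have "sgraph T \<lparr>verts = T, edges = {#e#}\<rparr>" "sgraph T \<lparr>verts = T, edges = M\<rparr>"
    using add.prems T by (auto simp: sgraph_def is_graph_def)
  then have "\<chi> (gunion \<lparr>verts = T, edges = {#e#}\<rparr> \<lparr>verts = T, edges = M\<rparr>)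
      = \<chi> \<lparr>verts = T, edges = {#e#}\<rparr> * \<chi> \<lparr>verts = T, edges = M\<rparr>"
    by (rule character_mult[OF \<chi>]) simp
  then show ?case using add by (simp add: gunion_def)
qed

text \<open>\<open>hom\<close> reads the endpoints of an edge as \<open>Min e\<close> and
  \<open>Max e\<close>; a strictly increasing renaming preserves their order, so summands match one
  by one.\<close>

lemma hom_gmap_strict_mono:
  assumes G: "is_graph G" and \<pi>: "strict_mono \<pi>"
  shows "hom (gmap \<pi> G) H = hom G H"
proof -
  let ?V = "verts G" and ?Q = "{..<worder H}"
  have inj: "inj_on \<pi> A" for A using \<pi> strict_mono_on_imp_inj_on by (metis inj_on_subset subset_UNIV)
  have M: "Min (\<pi> ` e) = \<pi> (Min e)" "Max (\<pi> ` e) = \<pi> (Max e)" "Min e \<in> ?V" "Max e \<in> ?V" if "e \<in># edges G" for e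
  proof -
    have e: "e \<subseteq> ?V" "card e = 2" using that G by (auto simp: is_graph_def)
    then have ne: "finite e" "e \<noteq> {}" by (auto intro: card_ge_0_finite)
    then show "Min (\<pi> ` e) = \<pi> (Min e)" "Max (\<pi> ` e) = \<pi> (Max e)"
      using strict_mono_mono[OF \<pi>] by (simp_all add: mono_Min_commute mono_Max_commute)
    show "Min e \<in> ?V" "Max e \<in> ?V" using e ne Min_in Max_in by blast+
  qed
  show ?thesis
    unfolding hom_def
  proof (rule sum.reindex_bij_witness[where i = "\<lambda>\<phi>. restrict (\<phi> \<circ> inv \<pi>) (\<pi> ` ?V)" and j = "\<lambda>\<phi>. restrict (\<phi> \<circ> \<pi>) ?V"])
    fix \<phi> assume \<phi>: "\<phi> \<in> verts (gmap \<pi> G) \<rightarrow>\<^sub>E ?Q"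
    show "restrict (restrict (\<phi> \<circ> \<pi>) ?V \<circ> inv \<pi>) (\<pi> ` ?V) = \<phi>"
    proof
      fix v show "restrict (restrict (\<phi> \<circ> \<pi>) ?V \<circ> inv \<pi>) (\<pi> ` ?V) v = \<phi> v"
        using \<phi> inj[of UNIV] by (cases "v \<in> \<pi> ` ?V") (auto simp: PiE_def extensional_def)
    qed
    show "restrict (\<phi> \<circ> \<pi>) ?V \<in> ?V \<rightarrow>\<^sub>E ?Q" using \<phi> by auto
    have "(\<Prod>u\<in>verts (gmap \<pi> G). vweight H (\<phi> u)) = (\<Prod>u\<in>?V. vweight H (restrict (\<phi> \<circ> \<pi>) ?V u))"
      by (simp add: prod.reindex[OF inj])
    moreover have "(\<Prod>e\<in>#edges (gmap \<pi> G). eweight H (\<phi> (Min e)) (\<phi> (Max e)))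
        = (\<Prod>e\<in>#edges G. eweight H (restrict (\<phi> \<circ> \<pi>) ?V (Min e)) (restrict (\<phi> \<circ> \<pi>) ?V (Max e)))"
      unfolding edges_gmap multiset.map_comp
      by (intro arg_cong[where f = prod_mset] image_mset_cong) (simp add: M)
    ultimately show "(\<Prod>u\<in>?V. vweight H (restrict (\<phi> \<circ> \<pi>) ?V u)) *
        (\<Prod>e\<in>#edges G. eweight H (restrict (\<phi> \<circ> \<pi>) ?V (Min e)) (restrict (\<phi> \<circ> \<pi>) ?V (Max e)))
        = (\<Prod>u\<in>verts (gmap \<pi> G). vweight H (\<phi> u)) *
        (\<Prod>e\<in>#edges (gmap \<pi> G). eweight H (\<phi> (Min e)) (\<phi> (Max e)))" by simp
  next
    fix \<phi> assume \<phi>: "\<phi> \<in> ?V \<rightarrow>\<^sub>E ?Q"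
    show "restrict (restrict (\<phi> \<circ> inv \<pi>) (\<pi> ` ?V) \<circ> \<pi>) ?V = \<phi>"
    proof
      fix v show "restrict (restrict (\<phi> \<circ> inv \<pi>) (\<pi> ` ?V) \<circ> \<pi>) ?V v = \<phi> v"
        using \<phi> inj[of UNIV] by (cases "v \<in> ?V") (auto simp: PiE_def extensional_def)
    qed
    show "restrict (\<phi> \<circ> inv \<pi>) (\<pi> ` ?V) \<in> verts (gmap \<pi> G) \<rightarrow>\<^sub>E ?Q"
      using \<phi> inj[of UNIV] by (auto simp: PiE_iff)
  qed
qed

lemma pair_permutation:
  assumes "a \<noteq> b" "a' \<noteq> b'" "a \<notin> S" "b \<notin> S" "a' \<notin> S" "b' \<notin> S"
  obtains \<sigma> where "bij \<sigma>" "\<sigma> a = a'" "\<sigma> b = b'" "\<And>v. v \<in> S \<Longrightarrow> \<sigma> v = v"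
\<comment> \<open>The inner transposition takes \<open>a\<close> to \<open>a'\<close>; the outer one
  corrects the image of \<open>b\<close> and leaves \<open>a'\<close> alone, since neither that
  image nor \<open>b'\<close> equals \<open>a'\<close>.\<close>
proof (rule that[of "transpose (transpose a a' b) b' \<circ> transpose a a'"])
  show "bij (transpose (transpose a a' b) b' \<circ> transpose a a')" by (intro bij_comp) simp_all
qed (use assms in \<open>auto simp: transpose_def\<close>)

text \<open>\<open>a0\<close> and \<open>b0\<close> are reference labels: vertex weights are read
  off at \<open>a0\<close>, edge weights at the pair.\<close>

locale max_fiber_system = char_system f X lam q
  for f :: "mgraph \<Rightarrow> 'a::field" and X lam q +
  fixes S :: "nat set" and \<psi> :: "mgraph \<Rightarrow> 'a" and a0 b0 D :: nat and enum :: "nat \<Rightarrow> mgraph \<Rightarrow> 'a"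
  assumes S: "finite S" and \<psi>: "\<psi> \<in> X S" and a0: "a0 \<notin> S" and b0: "b0 \<notin> S" and ab0: "a0 \<noteq> b0"
    and enum: "bij_betw enum {..<D} (fiber S (insert a0 S) \<psi>)"
    and maximal: "finite T \<Longrightarrow> \<xi> \<in> X T \<Longrightarrow> b \<notin> T \<Longrightarrow> card (fiber T (insert b T) \<xi>) \<le> D"
begin

text \<open>By maximality every fiber above \<open>\<psi>\<close> has exactly \<open>D\<close> elements. Its elements over one new label, for
  whichever label, become the vertices \<open>{..<D}\<close> of the weighted graph, and \<open>coord T a \<chi>\<close> is the vertex
  to which the character \<open>\<chi>\<close> sends the label \<open>a\<close>.\<close>

definition index :: "nat \<Rightarrow> (mgraph \<Rightarrow> 'a) \<Rightarrow> nat" where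
  "index a \<chi> = inv_into {..<D} enum (pull (transpose a a0) \<chi>)"

definition coord :: "nat set \<Rightarrow> nat \<Rightarrow> (mgraph \<Rightarrow> 'a) \<Rightarrow> nat" where
  "coord T a \<chi> = index a (restr (insert a S) T \<chi>)"

text \<open>The factor by which the coefficient changes when one label is placed at vertex
  \<open>i\<close>.\<close>

definition \<alpha> :: "nat \<Rightarrow> 'a" where
  "\<alpha> i = lam (insert a0 S) (enum i) / lam S \<psi>"

definition edge_graph :: "nat set \<Rightarrow> nat \<Rightarrow> nat \<Rightarrow> mgraph" where
  "edge_graph T a b = \<lparr>verts = T, edges = {#{a, b}#}\<rparr>"

definition coords :: "nat set \<Rightarrow> (mgraph \<Rightarrow> 'a) \<Rightarrow> nat \<Rightarrow> nat" where
  "coords W \<chi> = (\<lambda>a\<in>W. coord (S \<union> W) a \<chi>)"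

text \<open>The value of a single edge under the extension of \<psi> that sends \<open>a0\<close> to
  \<open>i\<close> and \<open>b0\<close> to \<open>j\<close>; for indices below \<open>D\<close> it
  is unique by \<open>bij_betw_coords\<close>.\<close>

definition \<beta> :: "nat \<Rightarrow> nat \<Rightarrow> 'a" where
  "\<beta> i j = inv_into (fiber S (S \<union> {a0, b0}) \<psi>) (coords {a0, b0})
     (\<lambda>a\<in>{a0, b0}. if a = a0 then i else j) (edge_graph (S \<union> {a0, b0}) a0 b0)"

section \<open>Coordinates of the extensions of a maximal character\<close>

lemma transpose_fixes: "a \<notin> S \<Longrightarrow> b \<notin> S \<Longrightarrow> v \<in> S \<Longrightarrow> transpose a b v = v"
  by (auto simp: transpose_def)

lemma bij_betw_pull_transpose:
  assumes a: "a \<notin> S"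
  shows "bij_betw (pull (transpose a a0)) (fiber S (insert a S) \<psi>) (fiber S (insert a0 S) \<psi>)"
proof (rule bij_betw_byWitness[where f' = "pull (transpose a a0)"])
  have inv: "pull (transpose a a0) (pull (transpose a a0) \<chi>) = \<chi>" for \<chi> :: "mgraph \<Rightarrow> 'a"
    by (rule pull_inverse) simp
  then show "\<forall>\<chi>\<in>fiber S (insert a S) \<psi>. pull (transpose a a0) (pull (transpose a a0) \<chi>) = \<chi>"
    "\<forall>\<chi>\<in>fiber S (insert a0 S) \<psi>. pull (transpose a a0) (pull (transpose a a0) \<chi>) = \<chi>" by simp_all
  have "pull (transpose a a0) \<chi> \<in> fiber S (insert a0 S) \<psi>" if "\<chi> \<in> fiber S (insert a S) \<psi>" for \<chi>
    using that S transpose_insert[OF a a0] transpose_fixes[OF a a0] by (intro pull_fiber) auto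
  then show "pull (transpose a a0) ` fiber S (insert a S) \<psi> \<subseteq> fiber S (insert a0 S) \<psi>" by blast
  have "pull (transpose a a0) \<chi> \<in> fiber S (insert a S) \<psi>" if "\<chi> \<in> fiber S (insert a0 S) \<psi>" for \<chi>
    using that S transpose_insert[OF a0 a] transpose_fixes[OF a a0]
    by (intro pull_fiber) (auto simp: transpose_commute)
  then show "pull (transpose a a0) ` fiber S (insert a0 S) \<psi> \<subseteq> fiber S (insert a S) \<psi>" by blast
qed

lemma bij_betw_index: "a \<notin> S \<Longrightarrow> bij_betw (index a) (fiber S (insert a S) \<psi>) {..<D}"
  unfolding index_def
  using bij_betw_trans[OF bij_betw_pull_transpose bij_betw_inv_into[OF enum]] by (simp add: comp_def)

lemma card_fiber: "a \<notin> S \<Longrightarrow> card (fiber S (insert a S) \<psi>) = D"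
  using bij_betw_same_card[OF bij_betw_index] by simp

lemma lam_fiber:
  assumes a: "a \<notin> S" and \<chi>: "\<chi> \<in> fiber S (insert a S) \<psi>"
  shows "lam (insert a S) \<chi> = lam S \<psi> * \<alpha> (index a \<chi>)"
proof -
  have X: "\<chi> \<in> X (transpose a a0 ` insert a0 S)"
    using \<chi> transpose_insert[OF a a0] by (simp add: fiber_def del: image_insert)
  have "pull (transpose a a0) \<chi> \<in> fiber S (insert a0 S) \<psi>"
    using \<chi> bij_betwE[OF bij_betw_pull_transpose[OF a]] by blast
  then have "enum (index a \<chi>) = pull (transpose a a0) \<chi>"
    unfolding index_def using enum by (simp add: bij_betw_inv_into_right)
  then show ?thesis
    using pull_X(2)[OF _ _ X] S lam_nonzero[OF S \<psi>] transpose_insert[OF a a0]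
    by (simp add: \<alpha>_def del: image_insert)
qed

text \<open>Amalgamation makes the restriction surjective onto a set of \<open>D\<close> elements,
  and maximality allows at most \<open>D\<close> extensions of \<xi>; so it is bijective. The
  amalgamation sum then has a single term, which gives the product rule.\<close>

lemma fiber_extension:
  assumes T: "S \<subseteq> T" "finite T" "b \<notin> T" and \<xi>: "\<xi> \<in> fiber S T \<psi>"
  shows "bij_betw (restr (insert b S) (insert b T)) (fiber T (insert b T) \<xi>) (fiber S (insert b S) \<psi>)"
    and "\<And>\<chi>. \<chi> \<in> fiber T (insert b T) \<xi> \<Longrightarrow>
      lam S \<psi> * lam (insert b T) \<chi> = lam T \<xi> * lam (insert b S) (restr (insert b S) (insert b T) \<chi>)"
proof -
  let ?r = "restr (insert b S) (insert b T)"
  have fin: "finite (insert b S)" "finite (insert b T)" using S T by auto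
  have meet: "T \<inter> insert b S = S" and join: "T \<union> insert b S = insert b T" using T by auto
  have bS: "b \<notin> S" using T by auto
  have sub: "T \<subseteq> insert b T" "insert b S \<subseteq> insert b T" "S \<subseteq> insert b S" using T by auto
  have \<xi>': "\<xi> \<in> X T" "restr S T \<xi> = \<psi>" using \<xi> by (auto simp: fiber_def)
  have into: "?r \<chi> \<in> fiber S (insert b S) \<psi>" if "\<chi> \<in> fiber T (insert b T) \<xi>" for \<chi>
  proof -
    have \<chi>: "\<chi> \<in> X (insert b T)" "restr T (insert b T) \<chi> = \<xi>" using that by (auto simp: fiber_def)
    have "restr S (insert b T) \<chi> = \<psi>"
      using restr_restr[OF character_X[OF fin(2) \<chi>(1)] T(1) sub(1) fin(2)] \<chi>(2) \<xi>'(2) by simp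
    then show ?thesis
      using \<chi>(1) by (intro fiber_restr sub fin) (simp add: fiber_def)
  qed
  have img: "?r ` fiber T (insert b T) \<xi> = fiber S (insert b S) \<psi>"
  proof
    show "?r ` fiber T (insert b T) \<xi> \<subseteq> fiber S (insert b S) \<psi>" using into by blast
    show "fiber S (insert b S) \<psi> \<subseteq> ?r ` fiber T (insert b T) \<xi>"
    proof
      fix \<zeta> assume "\<zeta> \<in> fiber S (insert b S) \<psi>"
      then obtain \<chi> where "\<chi> \<in> fiber T (insert b T) \<xi>" "?r \<chi> = \<zeta>"
        using amalgamation_exists[OF T(2) fin(1) meet \<xi>] join by metis
      then show "\<zeta> \<in> ?r ` fiber T (insert b T) \<xi>" by blast
    qed
  qed
  have "inj_on ?r (fiber T (insert b T) \<xi>)"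
  proof (rule eq_card_imp_inj_on)
    show finF: "finite (fiber T (insert b T) \<xi>)" by (rule finite_fiber[OF fin(2)])
    show "card (?r ` fiber T (insert b T) \<xi>) = card (fiber T (insert b T) \<xi>)"
      using maximal[OF T(2) \<xi>'(1) T(3)] card_image_le[OF finF, of ?r] card_fiber[OF bS] img by simp
  qed
  then show bij: "bij_betw ?r (fiber T (insert b T) \<xi>) (fiber S (insert b S) \<psi>)"
    using img by (simp add: bij_betw_def)
  fix \<chi> assume \<chi>: "\<chi> \<in> fiber T (insert b T) \<xi>"
  have "{\<chi>' \<in> fiber T (insert b T) \<xi>. ?r \<chi>' = ?r \<chi>} = {\<chi>}"
    using \<chi> bij by (auto simp: bij_betw_def dest: inj_onD)
  then show "lam S \<psi> * lam (insert b T) \<chi> = lam T \<xi> * lam (insert b S) (?r \<chi>)"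
    using amalgamation[OF T(2) fin(1) meet \<xi> into[OF \<chi>]] unfolding join by simp
qed

lemma coord_restr:
  assumes T: "insert a S \<subseteq> T" "T \<subseteq> U" "finite U" and \<chi>: "\<chi> \<in> X U"
  shows "coord T a (restr T U \<chi>) = coord U a \<chi>"
  using restr_restr[OF character_X[OF T(3) \<chi>] T] by (simp add: coord_def)

text \<open>Each added label contributes an independent coordinate by
  \<open>fiber_extension\<close>, and its product rule, divided by \<open>lam S \<psi>\<close>,
  contributes one factor \<alpha>.\<close>

lemma bij_betw_coords:
  assumes "finite W" "W \<inter> S = {}"
  shows "bij_betw (coords W) (fiber S (S \<union> W) \<psi>) (W \<rightarrow>\<^sub>E {..<D})"
    and "\<And>\<chi>. \<chi> \<in> fiber S (S \<union> W) \<psi> \<Longrightarrow> lam (S \<union> W) \<chi> = lam S \<psi> * (\<Prod>a\<in>W. \<alpha> (coord (S \<union> W) a \<chi>))"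
proof -
  have "bij_betw (coords W) (fiber S (S \<union> W) \<psi>) (W \<rightarrow>\<^sub>E {..<D}) \<and>
    (\<forall>\<chi>\<in>fiber S (S \<union> W) \<psi>. lam (S \<union> W) \<chi> = lam S \<psi> * (\<Prod>a\<in>W. \<alpha> (coord (S \<union> W) a \<chi>)))"
    using assms
  proof (induction W rule: finite_induct)
    case empty
    then show ?case using fiber_self[OF S \<psi>] by (simp add: bij_betw_def coords_def)
  next
    case (insert b W)
    let ?T = "S \<union> W"
    let ?U = "insert b ?T" and ?B = "insert b S"
    have T: "S \<subseteq> ?T" "finite ?T" "b \<notin> ?T" "finite ?U" and bS: "b \<notin> S" using insert S by auto
    have sub: "S \<subseteq> ?U" "?T \<subseteq> ?U" "?B \<subseteq> ?U" by auto
    note IH = insert.IH[THEN conjunct1] insert.IH[THEN conjunct2, rule_format]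
    have WS: "W \<inter> S = {}" using insert.prems by auto
    have X: "\<chi> \<in> X ?U" if "\<chi> \<in> fiber S ?U \<psi>" for \<chi> using that by (simp add: fiber_def)
    have rT: "restr ?T ?U \<chi> \<in> fiber S ?T \<psi>" if "\<chi> \<in> fiber S ?U \<psi>" for \<chi>
      using that by (intro fiber_restr T sub)
    have over: "\<chi> \<in> fiber ?T ?U (restr ?T ?U \<chi>)" if "\<chi> \<in> fiber S ?U \<psi>" for \<chi>
      using X[OF that] by (simp add: fiber_def)
    have rB: "restr ?B ?U \<chi> \<in> fiber S ?B \<psi>" if "\<chi> \<in> fiber S ?U \<psi>" for \<chi>
      using that by (intro fiber_restr T sub) auto
    have cW: "coord ?U a \<chi> = coord ?T a (restr ?T ?U \<chi>)" if "\<chi> \<in> fiber S ?U \<psi>" "a \<in> W" for a \<chi>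
      using that X by (intro coord_restr[symmetric] T sub) auto
    have cb: "coord ?U b \<chi> = index b (restr ?B ?U \<chi>)" for \<chi> by (simp add: coord_def)
    have coordsW: "coords W (restr ?T ?U \<chi>) = restrict (coords (insert b W) \<chi>) W" if "\<chi> \<in> fiber S ?U \<psi>" for \<chi>
      using cW[OF that] by (auto simp: coords_def fun_eq_iff)
    have coordsb: "coords (insert b W) \<chi> b = index b (restr ?B ?U \<chi>)" for \<chi>
      by (simp add: coords_def cb)
    have inj: "inj_on (coords (insert b W)) (fiber S ?U \<psi>)"
    proof (rule inj_onI)
      fix \<chi> \<chi>' assume \<chi>: "\<chi> \<in> fiber S ?U \<psi>" "\<chi>' \<in> fiber S ?U \<psi>" and eq: "coords (insert b W) \<chi> = coords (insert b W) \<chi>'"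
      have "coords W (restr ?T ?U \<chi>) = coords W (restr ?T ?U \<chi>')"
        using coordsW \<chi> eq by simp
      then have r: "restr ?T ?U \<chi> = restr ?T ?U \<chi>'"
        using inj_onD[OF bij_betw_imp_inj_on[OF IH(1)[OF WS]]] rT \<chi> by blast
      have "index b (restr ?B ?U \<chi>) = index b (restr ?B ?U \<chi>')" using coordsb eq by metis
      then have "restr ?B ?U \<chi> = restr ?B ?U \<chi>'"
        using inj_onD[OF bij_betw_imp_inj_on[OF bij_betw_index[OF bS]]] rB \<chi> by blast
      then show "\<chi> = \<chi>'"
        using inj_onD[OF bij_betw_imp_inj_on[OF fiber_extension(1)[OF T(1-3) rT[OF \<chi>(1)]]]]
          over[OF \<chi>(1)] over[OF \<chi>(2)] r by metis
    qed
    have into: "coords (insert b W) \<chi> \<in> insert b W \<rightarrow>\<^sub>E {..<D}" if \<chi>: "\<chi> \<in> fiber S ?U \<psi>" for \<chi>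
    proof -
      have "coords W (restr ?T ?U \<chi>) \<in> W \<rightarrow>\<^sub>E {..<D}"
        using bij_betwE[OF IH(1)[OF WS]] rT[OF \<chi>] by blast
      then have "coord ?U a \<chi> \<in> {..<D}" if "a \<in> W" for a
        using that cW[OF \<chi> that] by (auto simp: coords_def PiE_iff)
      moreover have "coord ?U b \<chi> \<in> {..<D}"
        unfolding cb using bij_betwE[OF bij_betw_index[OF bS]] rB[OF \<chi>] by blast
      ultimately show ?thesis by (simp add: coords_def PiE_iff)
    qed
    have surj: "g \<in> coords (insert b W) ` fiber S ?U \<psi>" if g: "g \<in> insert b W \<rightarrow>\<^sub>E {..<D}" for g
    proof -
      have "restrict g W \<in> W \<rightarrow>\<^sub>E {..<D}" using g by (auto simp: PiE_iff)
      then obtain \<xi> where \<xi>: "\<xi> \<in> fiber S ?T \<psi>" "coords W \<xi> = restrict g W"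
        using bij_betw_imp_surj_on[OF IH(1)[OF WS]] by (metis imageE)
      have "g b \<in> {..<D}" using g by auto
      then obtain \<zeta> where \<zeta>: "\<zeta> \<in> fiber S ?B \<psi>" "index b \<zeta> = g b"
        using bij_betw_imp_surj_on[OF bij_betw_index[OF bS]] by (metis imageE)
      obtain \<chi> where \<chi>: "\<chi> \<in> fiber ?T ?U \<xi>" "restr ?B ?U \<chi> = \<zeta>"
        using bij_betw_imp_surj_on[OF fiber_extension(1)[OF T(1-3) \<xi>(1)]] \<zeta>(1) by (metis imageE)
      have \<chi>X: "\<chi> \<in> X ?U" "restr ?T ?U \<chi> = \<xi>" using \<chi>(1) by (simp_all add: fiber_def)
      then have "restr S ?U \<chi> = \<psi>"
        using restr_restr[OF character_X[OF T(4) \<chi>X(1)] T(1) sub(2) T(4)] \<xi>(1) by (simp add: fiber_def)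
      then have \<chi>S: "\<chi> \<in> fiber S ?U \<psi>" using \<chi>X by (simp add: fiber_def)
      have "coords (insert b W) \<chi> = g"
      proof
        fix a show "coords (insert b W) \<chi> a = g a"
        proof (cases "a = b")
          case True
          then show ?thesis using coordsb \<chi>(2) \<zeta>(2) by simp
        next
          case False
          show ?thesis
          proof (cases "a \<in> W")
            case True
            then show ?thesis using fun_cong[OF coordsW[OF \<chi>S], of a] \<chi>X(2) \<xi>(2) by simp
          next
            case False
            then show ?thesis using \<open>a \<noteq> b\<close> g by (auto simp: coords_def PiE_iff extensional_def)
          qed
        qed
      qed
      then show ?thesis using \<chi>S by blast
    qed
    have U: "S \<union> insert b W = ?U" by simp
    have "coords (insert b W) ` fiber S ?U \<psi> = insert b W \<rightarrow>\<^sub>E {..<D}"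
      using into surj by blast
    then have "bij_betw (coords (insert b W)) (fiber S ?U \<psi>) (insert b W \<rightarrow>\<^sub>E {..<D})"
      using inj by (simp add: bij_betw_def)
    moreover have "lam ?U \<chi> = lam S \<psi> * (\<Prod>a\<in>insert b W. \<alpha> (coord ?U a \<chi>))" if \<chi>: "\<chi> \<in> fiber S ?U \<psi>" for \<chi>
    proof -
      have "lam S \<psi> * lam ?U \<chi> = lam ?T (restr ?T ?U \<chi>) * lam ?B (restr ?B ?U \<chi>)"
        by (rule fiber_extension(2)[OF T(1-3) rT[OF \<chi>] over[OF \<chi>]])
      also have "\<dots> = lam S \<psi> * (\<Prod>a\<in>W. \<alpha> (coord ?T a (restr ?T ?U \<chi>))) * (lam S \<psi> * \<alpha> (coord ?U b \<chi>))"
        using IH(2)[OF WS rT[OF \<chi>]] lam_fiber[OF bS rB[OF \<chi>]] by (simp add: cb)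
      also have "(\<Prod>a\<in>W. \<alpha> (coord ?T a (restr ?T ?U \<chi>))) = (\<Prod>a\<in>W. \<alpha> (coord ?U a \<chi>))"
        using cW[OF \<chi>] by (intro prod.cong) simp_all
      finally show ?thesis using lam_nonzero[OF S \<psi>] insert.hyps by (simp add: mult_ac)
    qed
    ultimately show ?case unfolding U by blast
  qed
  then show "bij_betw (coords W) (fiber S (S \<union> W) \<psi>) (W \<rightarrow>\<^sub>E {..<D})"
    "\<And>\<chi>. \<chi> \<in> fiber S (S \<union> W) \<psi> \<Longrightarrow> lam (S \<union> W) \<chi> = lam S \<psi> * (\<Prod>a\<in>W. \<alpha> (coord (S \<union> W) a \<chi>))"
    by blast+
qed

text \<open>\<open>\<sigma> \<circ> transpose a a0\<close> and
  \<open>transpose (\<sigma> a) a0\<close> both take \<open>a0\<close> to \<open>\<sigma> a\<close>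
  and fix \<open>S\<close>, so they pull characters back alike.\<close>

lemma coord_pull:
  assumes T: "insert a S \<subseteq> T" "finite T" and \<sigma>: "bij \<sigma>" "\<And>v. v \<in> S \<Longrightarrow> \<sigma> v = v"
    and a: "a \<notin> S" "\<sigma> a \<notin> S" and \<chi>: "\<chi> \<in> X (\<sigma> ` T)"
  shows "coord T a (pull \<sigma> \<chi>) = coord (\<sigma> ` T) (\<sigma> a) \<chi>"
proof -
  have \<sigma>S: "\<sigma> ` insert a S = insert (\<sigma> a) S" using \<sigma>(2) by (auto simp: image_def)
  have fin: "finite (insert a S)" using S by simp
  have finT: "finite (\<sigma> ` T)" using T by simp
  note c = character_X[OF finT \<chi>]
  have sub: "insert (\<sigma> a) S \<subseteq> \<sigma> ` T" using image_mono[OF T(1), of \<sigma>] unfolding \<sigma>S .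
  let ?\<zeta> = "restr (insert (\<sigma> a) S) (\<sigma> ` T) \<chi>"
  have \<zeta>: "character (insert (\<sigma> a) S) ?\<zeta>" by (rule character_restr[OF c sub finT])
  have "restr (insert a S) T (pull \<sigma> \<chi>) = pull \<sigma> ?\<zeta>"
    using restr_pull[OF c \<sigma>(1) T] unfolding \<sigma>S .
  then have "pull (transpose a a0) (restr (insert a S) T (pull \<sigma> \<chi>)) = pull (\<sigma> \<circ> transpose a a0) ?\<zeta>"
    by (simp add: pull_pull)
  also have "\<dots> = pull (transpose (\<sigma> a) a0) ?\<zeta>"
  proof (rule pull_cong[OF \<zeta>, where S = "insert a0 S"])
    show "bij (\<sigma> \<circ> transpose a a0)" using \<sigma>(1) by (intro bij_comp) simp_all
    show "(\<sigma> \<circ> transpose a a0) ` insert a0 S = insert (\<sigma> a) S"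
      unfolding image_comp[symmetric] transpose_insert[OF a(1) a0] \<sigma>S ..
    show "(\<sigma> \<circ> transpose a a0) v = transpose (\<sigma> a) a0 v" if "v \<in> insert a0 S" for v
      using that transpose_fixes[OF a(1) a0] transpose_fixes[OF a(2) a0] \<sigma>(2) by auto
  qed simp
  finally show ?thesis by (simp add: coord_def index_def)
qed

text \<open>A permutation fixing \<open>S\<close> moves the pair of labels to \<open>a0\<close> and
  \<open>b0\<close> without changing coordinates, which reduces the claim to the definition of
  \<beta>.\<close>

lemma edge_value:
  assumes ab: "a \<noteq> b" "a \<notin> S" "b \<notin> S" and \<chi>: "\<chi> \<in> fiber S (S \<union> {a, b}) \<psi>"
  shows "\<chi> (edge_graph (S \<union> {a, b}) a b) = \<beta> (coord (S \<union> {a, b}) a \<chi>) (coord (S \<union> {a, b}) b \<chi>)"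
proof -
  let ?T = "S \<union> {a, b}" and ?Z = "S \<union> {a0, b0}"
  obtain \<sigma> where \<sigma>: "bij \<sigma>" "\<sigma> a0 = a" "\<sigma> b0 = b" "\<And>v. v \<in> S \<Longrightarrow> \<sigma> v = v"
    using pair_permutation[OF ab0 ab(1) a0 b0 ab(2,3)] by metis
  have "\<sigma> ` S = S" using \<sigma>(4) by simp
  then have \<sigma>T: "\<sigma> ` ?Z = ?T" using \<sigma>(2,3) by (simp add: image_Un)
  let ?\<chi> = "pull \<sigma> \<chi>"
  have fin: "finite ?Z" using S by simp
  have \<chi>0: "?\<chi> \<in> fiber S ?Z \<psi>"
    using \<chi> \<sigma> \<sigma>T fin by (intro pull_fiber) auto
  have X: "\<chi> \<in> X (\<sigma> ` ?Z)" unfolding \<sigma>T using \<chi> by (simp add: fiber_def)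
  have c: "coord ?Z a0 ?\<chi> = coord ?T a \<chi>" "coord ?Z b0 ?\<chi> = coord ?T b \<chi>"
    using coord_pull[OF _ fin \<sigma>(1,4) _ _ X, of a0] coord_pull[OF _ fin \<sigma>(1,4) _ _ X, of b0] \<sigma>(2,3) ab a0 b0
    unfolding \<sigma>T by auto
  have "(\<lambda>v\<in>{a0, b0}. if v = a0 then coord ?T a \<chi> else coord ?T b \<chi>) = coords {a0, b0} ?\<chi>"
    unfolding coords_def c[symmetric] by (auto simp: fun_eq_iff)
  moreover have "inj_on (coords {a0, b0}) (fiber S ?Z \<psi>)"
    using bij_betw_coords(1)[of "{a0, b0}"] a0 b0 by (auto simp: bij_betw_def)
  ultimately have "\<beta> (coord ?T a \<chi>) (coord ?T b \<chi>) = ?\<chi> (edge_graph ?Z a0 b0)"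
    unfolding \<beta>_def using \<chi>0 by (simp only: inv_into_f_f)
  also have "\<dots> = \<chi> (edge_graph ?T a b)"
    using \<sigma>T \<sigma>(2,3) by (simp add: pull_def gmap_def edge_graph_def)
  finally show ?thesis ..
qed

text \<open>One edge value is computed with the two labels taken in either order; the edge itself is
  an unordered pair.\<close>

lemma \<beta>_commute:
  assumes "i < D" "j < D" shows "\<beta> i j = \<beta> j i"
proof -
  let ?T = "S \<union> {a0, b0}" and ?g = "\<lambda>v\<in>{a0, b0}. if v = a0 then i else j"
  have "?g \<in> {a0, b0} \<rightarrow>\<^sub>E {..<D}" using assms by auto
  moreover have "coords {a0, b0} ` fiber S ?T \<psi> = {a0, b0} \<rightarrow>\<^sub>E {..<D}"
    using a0 b0 by (intro bij_betw_imp_surj_on[OF bij_betw_coords(1)]) auto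
  ultimately have "?g \<in> coords {a0, b0} ` fiber S ?T \<psi>" by blast
  then obtain \<chi> where \<chi>: "\<chi> \<in> fiber S ?T \<psi>" "?g = coords {a0, b0} \<chi>" by blast
  have c: "coord ?T a0 \<chi> = i" "coord ?T b0 \<chi> = j"
    using fun_cong[OF \<chi>(2), of a0] fun_cong[OF \<chi>(2), of b0] ab0 by (auto simp: coords_def)
  have swap: "S \<union> {b0, a0} = ?T" "edge_graph ?T b0 a0 = edge_graph ?T a0 b0"
    by (auto simp: edge_graph_def insert_commute)
  have "\<chi> (edge_graph ?T a0 b0) = \<beta> i j"
    using edge_value[OF ab0 a0 b0 \<chi>(1)] by (simp only: c)
  moreover have "\<chi> (edge_graph ?T a0 b0) = \<beta> j i"
    using edge_value[of b0 a0 \<chi>, unfolded swap, OF ab0[symmetric] b0 a0 \<chi>(1)] by (simp only: c)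
  ultimately show ?thesis by simp
qed

section \<open>The homomorphism formula\<close>

definition target :: "'a wgraph" where
  "target = \<lparr>worder = D, vweight = \<alpha>, eweight = \<beta>\<rparr>"

lemma target_sel [simp]: "worder target = D" "vweight target = \<alpha>" "eweight target = \<beta>"
  by (simp_all add: target_def)

lemma weighted_graph_target: "weighted_graph target"
proof -
  have "\<alpha> i \<noteq> 0" if "i < D" for i
  proof -
    have "enum i \<in> X (insert a0 S)" using bij_betwE[OF enum] that by (auto simp: fiber_def)
    then show ?thesis using lam_nonzero S \<psi> by (simp add: \<alpha>_def)
  qed
  then show ?thesis using \<beta>_commute by (auto simp: weighted_graph_def)
qed

text \<open>The nodes of \<open>G\<close> become new labels, so the characters expanding \<psi> are
  the maps from \<open>verts G\<close> to \<open>{..<D}\<close>. Disjointness from \<open>S\<close>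
  makes them new.\<close>

lemma f_eq_hom_disjoint:
  assumes G: "is_graph G" and GS: "verts G \<inter> S = {}"
  shows "f G = hom G target"
proof -
  let ?W = "verts G"
  let ?T = "S \<union> ?W"
  have W: "finite ?W" and fin: "finite ?T" using G S by (auto simp: is_graph_def)
  have edges: "e \<subseteq> ?W \<and> card e = 2" if "e \<in># edges G" for e using that G by (auto simp: is_graph_def)
  let ?H = "gunion G (edgeless S)"
  have H: "?H = \<lparr>verts = ?T, edges = edges G\<rparr>" by (simp add: gunion_def Un_commute)
  have sH: "sgraph ?T ?H" using G S by (auto simp: sgraph_def)
  obtain \<xi> where \<xi>: "X {} = {\<xi>}" "\<And>G. is_graph G \<Longrightarrow> \<xi> G = f G" by (rule X_empty) metis
  \<comment> \<open>The restriction of \<psi> to no labels lies in \<open>X {}\<close>, whose only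
    element agrees with \<open>f\<close> on graphs.\<close>
  have "f G = restr {} S \<psi> G"
    using \<xi> restr_X[OF _ S \<psi>, of "{}"] G by auto
  also have "\<dots> = \<psi> ?H"
    using restr_eq[OF character_X[OF S \<psi>] _ _ S, of "{}" G] G GS by (auto simp: sgraph_def)
  finally have "lam S \<psi> * f G = (\<Sum>\<chi>\<in>fiber S ?T \<psi>. lam ?T \<chi> * \<chi> ?H)"
    using restr_expansion[OF _ fin sH, of S \<psi>] \<psi> by simp
  also have "\<dots> = (\<Sum>\<chi>\<in>fiber S ?T \<psi>. lam S \<psi> * ((\<Prod>u\<in>?W. vweight target (coords ?W \<chi> u)) *
      (\<Prod>e\<in>#edges G. eweight target (coords ?W \<chi> (Min e)) (coords ?W \<chi> (Max e)))))"
  proof (rule sum.cong)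
    fix \<chi> assume \<chi>: "\<chi> \<in> fiber S ?T \<psi>"
    then have X: "\<chi> \<in> X ?T" by (simp add: fiber_def)
    note c = character_X[OF fin X]
    \<comment> \<open>Restricting to the endpoints of \<open>e\<close> leaves two new labels, where
      \<open>edge_value\<close> applies, and preserves both coordinates.\<close>
    have edge: "\<chi> \<lparr>verts = ?T, edges = {#e#}\<rparr> = \<beta> (coords ?W \<chi> (Min e)) (coords ?W \<chi> (Max e))" if "e \<in># edges G" for e
    proof -
      have e: "e \<subseteq> ?W" "card e = 2" using edges[OF that] by auto
      then obtain x y where xy: "e = {x, y}" "x \<noteq> y" by (auto simp: card_2_iff)
      define a b where "a = Min e" and "b = Max e"
      have ab: "e = {a, b}" "a \<noteq> b" using xy by (auto simp: a_def b_def min_def max_def)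
      have abW: "a \<in> ?W" "b \<in> ?W" "a \<notin> S" "b \<notin> S" using ab e GS by auto
      let ?R = "S \<union> {a, b}"
      have R: "S \<subseteq> ?R" "?R \<subseteq> ?T" "insert a S \<subseteq> ?R" "insert b S \<subseteq> ?R" using abW by auto
      have sE: "sgraph ?R (edge_graph ?R a b)"
        using S ab by (auto simp: sgraph_def is_graph_def edge_graph_def)
      have "restr ?R ?T \<chi> (edge_graph ?R a b) = \<chi> (gunion (edge_graph ?R a b) (edgeless ?T))"
        by (rule restr_eq[OF c sE R(2) fin]) (simp add: edge_graph_def)
      also have "gunion (edge_graph ?R a b) (edgeless ?T) = \<lparr>verts = ?T, edges = {#e#}\<rparr>"
        unfolding gunion_def edge_graph_def using Un_absorb1[OF R(2)] ab(1) by simp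
      finally have "\<chi> \<lparr>verts = ?T, edges = {#e#}\<rparr> = restr ?R ?T \<chi> (edge_graph ?R a b)" ..
      also have "\<dots> = \<beta> (coord ?R a (restr ?R ?T \<chi>)) (coord ?R b (restr ?R ?T \<chi>))"
        by (rule edge_value[OF ab(2) abW(3,4) fiber_restr[OF R(1,2) fin \<chi>]])
      also have "\<dots> = \<beta> (coord ?T a \<chi>) (coord ?T b \<chi>)"
        using coord_restr[OF R(3,2) fin X] coord_restr[OF R(4,2) fin X] by simp
      finally show ?thesis using abW unfolding a_def[symmetric] b_def[symmetric] by (simp add: coords_def)
    qed
    have "\<chi> ?H = (\<Prod>e\<in>#edges G. \<chi> \<lparr>verts = ?T, edges = {#e#}\<rparr>)"
      unfolding H using edges by (intro character_edges[OF c fin]) auto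
    also have "\<dots> = (\<Prod>e\<in>#edges G. \<beta> (coords ?W \<chi> (Min e)) (coords ?W \<chi> (Max e)))"
      using edge by (intro arg_cong[where f = prod_mset] image_mset_cong) simp
    finally show "lam ?T \<chi> * \<chi> ?H = lam S \<psi> * ((\<Prod>u\<in>?W. vweight target (coords ?W \<chi> u)) *
      (\<Prod>e\<in>#edges G. eweight target (coords ?W \<chi> (Min e)) (coords ?W \<chi> (Max e))))"
      using bij_betw_coords(2)[OF W GS \<chi>] by (simp add: coords_def mult.assoc)
  qed simp
  also have "\<dots> = lam S \<psi> * hom G target"
    unfolding hom_def sum_distrib_left[symmetric] target_sel(1)
    by (subst sum.reindex_bij_betw[OF bij_betw_coords(1)[OF W GS], symmetric]) simp
  finally show ?thesis using lam_nonzero[OF S \<psi>] by simp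
qed

text \<open>A translation moves \<open>G\<close> off \<open>S\<close> while keeping the order of the
  nodes.\<close>

lemma f_eq_hom:
  assumes G: "is_graph G" shows "f G = hom G target"
proof -
  define N where "N = Suc (Max (insert 0 S))"
  have mono: "strict_mono (\<lambda>v. v + N)" by (simp add: strict_mono_def)
  have inj: "inj_on (\<lambda>v. v + N) (verts G)" by simp
  have "v + N \<notin> S" for v
  proof
    assume "v + N \<in> S"
    then have "v + N \<le> Max (insert 0 S)" using S by (intro Max_ge) auto
    then show False by (simp add: N_def)
  qed
  then have "verts (gmap (\<lambda>v. v + N) G) \<inter> S = {}" by auto
  then have "f (gmap (\<lambda>v. v + N) G) = hom (gmap (\<lambda>v. v + N) G) target"
    using is_graph_gmap[OF G inj] by (intro f_eq_hom_disjoint)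
  then show ?thesis using f_gmap[OF G inj] hom_gmap_strict_mono[OF G mono] by simp
qed

end

context char_system
begin

lemma exists_weighted_graph:
  "\<exists>H :: 'a wgraph. weighted_graph H \<and> worder H \<le> q \<and> (\<forall>G. is_graph G \<longrightarrow> f G = hom G H)"
proof -
  \<comment> \<open>The attained one-label fiber sizes; they are bounded by \<open>q\<close>, so a
    largest one exists.\<close>
  define P where "P d \<longleftrightarrow> (\<exists>S \<psi> a. finite S \<and> \<psi> \<in> X S \<and> a \<notin> S \<and> card (fiber S (insert a S) \<psi>) = d)" for d
  have bound: "\<forall>d. P d \<longrightarrow> d \<le> q" unfolding P_def using card_fiber_le by blast
  obtain \<xi> where "X {} = {\<xi>}" by (rule X_empty)
  then have "P (card (fiber {} {0} \<xi>))" unfolding P_def by (intro exI[of _ "{}"] exI[of _ \<xi>] exI[of _ 0]) auto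
  then have "P (Greatest P)" and greatest: "\<And>d. P d \<Longrightarrow> d \<le> Greatest P"
    using GreatestI_nat[of P _ q] Greatest_le_nat[of P _ q] bound by blast+
  then obtain S \<psi> a0 where S: "finite S" "\<psi> \<in> X S" "a0 \<notin> S" "card (fiber S (insert a0 S) \<psi>) = Greatest P"
    unfolding P_def by blast
  obtain b0 where b0: "b0 \<notin> insert a0 S" using ex_new_if_finite[OF infinite_UNIV_nat] S(1) by blast
  have "finite (fiber S (insert a0 S) \<psi>)" using S(1) by (simp add: finite_fiber)
  then obtain enum where enum: "bij_betw enum {..<Greatest P} (fiber S (insert a0 S) \<psi>)"
    using ex_bij_betw_nat_finite S(4) by (metis atLeast0LessThan)
  interpret max_fiber_system f X lam q S \<psi> a0 b0 "Greatest P" enum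
  proof
    fix T \<xi> b assume "finite T" "\<xi> \<in> X T" "b \<notin> T"
    then have "P (card (fiber T (insert b T) \<xi>))" unfolding P_def by blast
    then show "card (fiber T (insert b T) \<xi>) \<le> Greatest P" by (rule greatest)
  qed (use S b0 enum in auto)
  have "Greatest P \<le> q" using \<open>P (Greatest P)\<close> bound by blast
  then show ?thesis using weighted_graph_target f_eq_hom by (intro exI[of _ target]) simp
qed

end

theorem theorem3p4:
  fixes f :: "mgraph \<Rightarrow> 'a::field" and q :: nat
  assumes "graph_parameter f"
    and "f K0 = 1"
    and "\<And>k n. sym_rank k n (conn_tensor f k) \<le> enat (q ^ k)"
  shows "\<exists>H :: 'a wgraph. weighted_graph H \<and> worder H \<le> q \<and>
           (\<forall>G. is_graph G \<longrightarrow> f G = hom G H)"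
proof -
  define good where "good S X l \<longleftrightarrow> finite X \<and> card X \<le> q ^ card S \<and> (\<forall>\<chi>\<in>X. character S \<chi> \<and> l \<chi> \<noteq> 0) \<and>
      (\<forall>G. sgraph S G \<longrightarrow> f G = (\<Sum>\<chi>\<in>X. l \<chi> * \<chi> G))" for S X l
  have ex: "\<exists>X l. good S X l" if S: "finite S" for S
  proof -
    obtain X l where "finite X" "card X \<le> q ^ card S" "\<And>\<chi>. \<chi> \<in> X \<Longrightarrow> character S \<chi>" "\<And>\<chi>. \<chi> \<in> X \<Longrightarrow> l \<chi> \<noteq> 0"
      "\<And>G. sgraph S G \<Longrightarrow> f G = (\<Sum>\<chi>\<in>X. l \<chi> * \<chi> G)"
      by (rule graph_parameter_character_sum[OF assms(1) assms(3) S refl]) (rule that)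
    then have "good S X l" by (simp add: good_def)
    then show ?thesis by blast
  qed
  \<comment> \<open>Two successive choices: a set admitting some coefficients, and coefficients for
    that set.\<close>
  define X where "X S = (SOME Y. \<exists>l. good S Y l)" for S
  define lam where "lam S = (SOME l. good S (X S) l)" for S
  have good: "good S (X S) (lam S)" if "finite S" for S
  proof -
    have "\<exists>l. good S (X S) l" unfolding X_def by (rule someI_ex[OF ex[OF that]])
    then show ?thesis unfolding lam_def by (rule someI_ex)
  qed
  interpret char_system f X lam q
  proof
    show "f (gmap \<pi> G) = f G" if "is_graph G" "inj_on \<pi> (verts G)" for G \<pi>
      by (rule graph_parameter_gmap[OF assms(1) that])
    show "f K0 = 1" by (rule assms(2))
    show "f G = (\<Sum>\<chi>\<in>X S. lam S \<chi> * \<chi> G)" if "sgraph S G" for S G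
      using good[OF sgraph_finite(2)[OF that]] that unfolding good_def by blast
    fix S :: "nat set" assume "finite S"
    note g = good[OF this, unfolded good_def]
    show "finite (X S)" "card (X S) \<le> q ^ card S" using g by blast+
    show "character S \<chi>" "lam S \<chi> \<noteq> 0" if "\<chi> \<in> X S" for \<chi> using g that by blast+
  qed
  show ?thesis by (rule exists_weighted_graph)
qed

end
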